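(* Let $\Omega=\mathbb{R}^3\setminus\overline{B}(0,1)$ and fix $1\le p<\infty$. There exists a constant $C$ such that for every radial function $u\in\dot H^1_D(\Omega)\cap L^p(\Omega)$, $$r^{\frac{4}{p+2}}|u(r)|\le C\,\|u\|_{L^p(\Omega)}^{\frac{p}{p+2}}\,\|u\|_{\dot H^1_{D}(\Omega)}^{\frac{2}{p+2}}$$ for almost every $r\ge1$. In particular, the radial functions in $\dot H^1_D(\Omega)$ belong to $L^\infty(\Omega)$, i.e. $\dot H^1_{D,rad}(\Omega)\subset L^\infty(\Omega)$.
   Context: $\dot H^1_D(\Omega)$ is the completion of $C_c^\infty(\Omega)$ under the norm $\|u\|_{\dot H^1_D(\Omega)}=\|(-\Delta_\Omega)^{1/2}u\|_{L^2(\Omega)}$, where $\Delta_\Omega$ is the Dirichlet Laplacian on $\Omega$. The subscript "rad" denotes the subspace of radial functions. For radial $u$ we write $u(r)$ for the value of $u$ at $|x|=r$. *)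

theory Defs
  imports "HOL-Analysis.Analysis"
begin

section \<open>Lebesgue spaces\<close>

text \<open>
  Elements of function spaces on \<open>\<Omega>\<close> are represented by functions on the whole ambient space; the
  values outside \<open>\<Omega>\<close> are irrelevant, and functions agreeing almost everywhere on \<open>\<Omega>\<close> represent
  the same element.
\<close>

definition Lp :: "real \<Rightarrow> 'a::euclidean_space set \<Rightarrow> ('a \<Rightarrow> 'b::euclidean_space) set" where
  "Lp p \<Omega> = {f \<in> borel_measurable (lebesgue_on \<Omega>).
      integrable (lebesgue_on \<Omega>) (\<lambda>x. norm (f x) powr p)}"

definition Lp_norm :: "real \<Rightarrow> 'a::euclidean_space set \<Rightarrow> ('a \<Rightarrow> 'b::euclidean_space) \<Rightarrow> real" where
  "Lp_norm p \<Omega> f = (LINT x|lebesgue_on \<Omega>. norm (f x) powr p) powr (1 / p)"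

definition Linfty :: "'a::euclidean_space set \<Rightarrow> ('a \<Rightarrow> 'b::euclidean_space) set" where
  "Linfty \<Omega> = {f \<in> borel_measurable (lebesgue_on \<Omega>).
      \<exists>M. AE x in lebesgue_on \<Omega>. norm (f x) \<le> M}"

definition L2_inner :: "'a::euclidean_space set \<Rightarrow> ('a \<Rightarrow> complex) \<Rightarrow> ('a \<Rightarrow> complex) \<Rightarrow> complex" where
  "L2_inner \<Omega> f g = (LINT x|lebesgue_on \<Omega>. f x * cnj (g x))"

section \<open>Test functions\<close>

definition partial :: "3 \<Rightarrow> (real^3 \<Rightarrow> complex) \<Rightarrow> real^3 \<Rightarrow> complex" where
  "partial i f x = frechet_derivative f (at x) (axis i 1)"

definition grad :: "(real^3 \<Rightarrow> complex) \<Rightarrow> real^3 \<Rightarrow> complex^3" where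
  "grad f x = (\<chi> i. partial i f x)"

fun Ck :: "nat \<Rightarrow> (real^3 \<Rightarrow> complex) \<Rightarrow> bool" where
  "Ck 0 f \<longleftrightarrow> continuous_on UNIV f"
| "Ck (Suc k) f \<longleftrightarrow> f differentiable_on UNIV \<and> (\<forall>i. Ck k (partial i f))"

text \<open>\<open>C\<^sub>c\<^sup>\<infinity>(\<Omega>)\<close>, extended by zero to the whole space.\<close>

definition test_functions :: "(real^3) set \<Rightarrow> (real^3 \<Rightarrow> complex) set" where
  "test_functions \<Omega> = {\<phi>. (\<forall>k. Ck k \<phi>) \<and>
      compact (closure {x. \<phi> x \<noteq> 0}) \<and> closure {x. \<phi> x \<noteq> 0} \<subseteq> \<Omega>}"

section \<open>The Dirichlet Laplacian and its square root\<close>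

text \<open>
  An unbounded operator in \<open>L\<^sup>2(\<Omega>)\<close> is given by its graph, a set of pairs of functions closed under
  changes on null sets in both components. Composition of operators is then relational composition.
\<close>

text \<open>
  \<open>H10_grad \<Omega> u g\<close>: \<open>u\<close> belongs to \<open>H\<^sub>0\<^sup>1(\<Omega>)\<close>, the closure of the test functions in \<open>H\<^sup>1\<close>, and
  \<open>g\<close> is its weak gradient.
\<close>

definition H10_grad :: "(real^3) set \<Rightarrow> (real^3 \<Rightarrow> complex) \<Rightarrow> (real^3 \<Rightarrow> complex^3) \<Rightarrow> bool" where
  "H10_grad \<Omega> u g \<longleftrightarrow> u \<in> Lp 2 \<Omega> \<and> g \<in> Lp 2 \<Omega> \<and>
     (\<exists>\<phi>. (\<forall>n::nat. \<phi> n \<in> test_functions \<Omega>) \<and>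
        (\<lambda>n. Lp_norm 2 \<Omega> (\<lambda>x. \<phi> n x - u x)) \<longlonglongrightarrow> 0 \<and>
        (\<lambda>n. Lp_norm 2 \<Omega> (\<lambda>x. grad (\<phi> n) x - g x)) \<longlonglongrightarrow> 0)"

text \<open>
  \<open>-\<Delta>\<^sub>\<Omega>\<close> is the self-adjoint operator of the form \<open>\<integral>\<^sub>\<Omega> \<nabla>u \<cdot> cnj (\<nabla>v)\<close> with form domain
  \<open>H\<^sub>0\<^sup>1(\<Omega>)\<close>; it suffices to test with the form core of test functions.
\<close>

definition neg_Dirichlet_Laplacian ::
    "(real^3) set \<Rightarrow> ((real^3 \<Rightarrow> complex) \<times> (real^3 \<Rightarrow> complex)) set" where
  "neg_Dirichlet_Laplacian \<Omega> = {(u, f). f \<in> Lp 2 \<Omega> \<and>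
     (\<exists>g. H10_grad \<Omega> u g \<and>
        (\<forall>\<phi>\<in>test_functions \<Omega>.
           (LINT x|lebesgue_on \<Omega>. (\<Sum>i\<in>UNIV. g x $ i * cnj (grad \<phi> x $ i))) = L2_inner \<Omega> f \<phi>))}"

definition op_adjoint ::
    "'a::euclidean_space set \<Rightarrow> (('a \<Rightarrow> complex) \<times> ('a \<Rightarrow> complex)) set
      \<Rightarrow> (('a \<Rightarrow> complex) \<times> ('a \<Rightarrow> complex)) set" where
  "op_adjoint \<Omega> T = {(u, f). u \<in> Lp 2 \<Omega> \<and> f \<in> Lp 2 \<Omega> \<and>
     (\<forall>(v, h)\<in>T. L2_inner \<Omega> h u = L2_inner \<Omega> v f)}"

definition densely_defined ::
    "'a::euclidean_space set \<Rightarrow> (('a \<Rightarrow> complex) \<times> ('a \<Rightarrow> complex)) set \<Rightarrow> bool" where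
  "densely_defined \<Omega> T \<longleftrightarrow>
     (\<forall>u\<in>Lp 2 \<Omega>. \<forall>e>0. \<exists>v\<in>Domain T. Lp_norm 2 \<Omega> (\<lambda>x. u x - v x) < e)"

text \<open>
  An adjoint is automatically linear and closed, and the adjoint of a densely defined relation is
  single-valued modulo null sets, so these properties need not be listed.
\<close>

definition nonneg_selfadjoint ::
    "'a::euclidean_space set \<Rightarrow> (('a \<Rightarrow> complex) \<times> ('a \<Rightarrow> complex)) set \<Rightarrow> bool" where
  "nonneg_selfadjoint \<Omega> T \<longleftrightarrow> densely_defined \<Omega> T \<and> op_adjoint \<Omega> T = T \<and>
     (\<forall>(u, f)\<in>T. 0 \<le> Re (L2_inner \<Omega> f u))"

text \<open>
  A nonnegative self-adjoint operator has exactly one nonnegative self-adjoint square root, so the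
  union below is over a single graph.
\<close>

definition op_sqrt ::
    "'a::euclidean_space set \<Rightarrow> (('a \<Rightarrow> complex) \<times> ('a \<Rightarrow> complex)) set
      \<Rightarrow> (('a \<Rightarrow> complex) \<times> ('a \<Rightarrow> complex)) set" where
  "op_sqrt \<Omega> A = \<Union> {S. nonneg_selfadjoint \<Omega> S \<and> S O S = A}"

section \<open>The homogeneous Sobolev space\<close>

text \<open>
  \<open>\<parallel>(-\<Delta>\<^sub>\<Omega>)\<^sup>1\<^sup>/\<^sup>2 \<phi>\<parallel>\<close> in \<open>L\<^sup>2(\<Omega>)\<close>, with value \<open>\<infinity>\<close> outside the operator domain. The image of \<open>\<phi>\<close>
  is unique modulo null sets, so the infimum is over at most one value.
\<close>

definition sqrt_Laplacian_norm :: "(real^3) set \<Rightarrow> (real^3 \<Rightarrow> complex) \<Rightarrow> ennreal" where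
  "sqrt_Laplacian_norm \<Omega> \<phi> =
     (INF s\<in>{s. (\<phi>, s) \<in> op_sqrt \<Omega> (neg_Dirichlet_Laplacian \<Omega>)}. ennreal (Lp_norm 2 \<Omega> s))"

text \<open>
  The completion is realised as a space of functions: an element is a locally integrable \<open>u\<close> that is
  the limit in \<open>L\<^sup>1\<^sub>l\<^sub>o\<^sub>c(\<Omega>)\<close> of a Cauchy sequence of test functions. In dimension three the
  Sobolev inequality shows that every Cauchy sequence converges in \<open>L\<^sup>6(\<Omega>)\<close>, hence in
  \<open>L\<^sup>1\<^sub>l\<^sub>o\<^sub>c(\<Omega>)\<close>, and that two of them have the same limit only if they are equivalent, so for
  open \<open>\<Omega>\<close> this is the abstract completion.
\<close>

definition Hdot1_approx ::
    "(real^3) set \<Rightarrow> (nat \<Rightarrow> real^3 \<Rightarrow> complex) \<Rightarrow> (real^3 \<Rightarrow> complex) \<Rightarrow> bool" where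
  "Hdot1_approx \<Omega> \<phi> u \<longleftrightarrow>
     (\<forall>n. \<phi> n \<in> test_functions \<Omega>) \<and>
     (\<forall>e::real. e > 0 \<longrightarrow> (\<exists>N. \<forall>m\<ge>N. \<forall>n\<ge>N.
        sqrt_Laplacian_norm \<Omega> (\<lambda>x. \<phi> m x - \<phi> n x) < ennreal e)) \<and>
     (\<forall>K. compact K \<and> K \<subseteq> \<Omega> \<longrightarrow>
        u \<in> Lp 1 K \<and> (\<lambda>n. Lp_norm 1 K (\<lambda>x. \<phi> n x - u x)) \<longlonglongrightarrow> 0)"

definition Hdot1 :: "(real^3) set \<Rightarrow> (real^3 \<Rightarrow> complex) set" where
  "Hdot1 \<Omega> = {u. \<exists>\<phi>. Hdot1_approx \<Omega> \<phi> u}"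

text \<open>
  The norm of the completion, i.e. the limit of the norms along an approximating sequence. The limit
  does not depend on the sequence, so for \<open>u \<in> Hdot1 \<Omega>\<close> the infimum is over a single finite value.
\<close>

definition Hdot1_norm :: "(real^3) set \<Rightarrow> (real^3 \<Rightarrow> complex) \<Rightarrow> real" where
  "Hdot1_norm \<Omega> u = enn2real (Inf {c. \<exists>\<phi>. Hdot1_approx \<Omega> \<phi> u \<and>
     (\<lambda>n. sqrt_Laplacian_norm \<Omega> (\<phi> n)) \<longlonglongrightarrow> c})"

section \<open>Radial functions on the exterior of the unit ball\<close>

definition exterior :: "(real^3) set" where
  "exterior = UNIV - cball 0 1"

text \<open>\<open>U r\<close> is the value of the radial function \<open>u\<close> at \<open>|x| = r\<close>.\<close>

definition radial_profile ::
    "(real^3) set \<Rightarrow> (real^3 \<Rightarrow> complex) \<Rightarrow> (real \<Rightarrow> complex) \<Rightarrow> bool" where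
  "radial_profile \<Omega> u U \<longleftrightarrow> (AE x in lebesgue_on \<Omega>. u x = U (norm x))"

definition radial :: "(real^3) set \<Rightarrow> (real^3 \<Rightarrow> complex) \<Rightarrow> bool" where
  "radial \<Omega> u \<longleftrightarrow> (\<exists>U. radial_profile \<Omega> u U)"

end

(*
The profile of a radial function is the restriction of the function to (almost) any ray, so no
spherical averages of the approximating test functions are needed. By Fubini and scaling, the
integral over the shell 1 < |y| < 2 of int_0^oo h(ty) t^(n-1) dt equals ln 2 times the integral
of h; by Fatou's lemma and a Markov estimate some ray y therefore carries, along a subsequence,
at most a fixed multiple of the gradient energy and of the p-norm, while the test functions
converge almost everywhere on it. There the claim is the one-dimensional estimate

  |f(t)|^q <= q int_t^oo |f|^(q-1) |f'| ds <= q t^(-2) (int |f|^p s^2)^(1/2) (int |f'|^2 s^2)^(1/2)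

with q = (p + 2) / 2. The operator square root enters only through ||S phi|| = ||grad phi|| for
test functions phi: a square root S of the Laplacian A satisfies
<S phi, S phi> = <A phi, phi> = <grad phi, grad phi>.
*)
theory Submission
  imports Defs
begin

section \<open>Weighted estimates on a half-line\<close>

text \<open>The approximating test functions are controlled in energy only; nothing bounds their
  p-norms. Hence no p-integral of an approximant is estimated uniformly. On a compact piece [t, R]
  of the ray, the decay \<open>sqrt (E / t)\<close>, a consequence of the energy alone, dominates
  the integrands, so the p-integrals there converge to that of the limit, and only this limit is
  compared with the p-norm of u. The price is a boundary term at R, which the same decay removes as
  R tends to infinity. The profile need not be Borel measurable, so the limit integrand is written
  as a liminf of continuous functions. Cauchy-Schwarz is carried out as a pointwise Young inequality
  whose weight requires positive bounds; energy and p-norm are therefore replaced by slightly larger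
  numbers, and the excess tends to zero at the end, which also settles vanishing norms. Rays are
  indexed by an open shell instead of the sphere, so Lebesgue measure serves throughout in place of
  surface measure; since |y| is known only to lie between 1 and 2, constants grow by powers of
  2.\<close>

lemma norm_diff_le_integral_norm:
  fixes f :: "real \<Rightarrow> 'b::euclidean_space"
  assumes "a \<le> b"
    and d: "\<And>s. s \<in> {a..b} \<Longrightarrow> (f has_vector_derivative f' s) (at s within {a..b})"
    and c: "continuous_on {a..b} f'" "continuous_on {a..b} g"
    and le: "\<And>s. s \<in> {a..b} \<Longrightarrow> norm (f' s) \<le> g s"
  shows "norm (f b - f a) \<le> integral {a..b} g"
proof -
  have "f b - f a = integral {a..b} f'"
    using fundamental_theorem_of_calculus[OF assms(1) d] by (simp add: integral_unique)
  also have "norm \<dots> \<le> integral {a..b} g"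
    using c le by (intro integral_norm_bound_integral integrable_continuous_interval) auto
  finally show ?thesis .
qed

lemma weighted_energy_increment:
  fixes f :: "real \<Rightarrow> 'b::euclidean_space"
  assumes t: "0 < t" "t \<le> R"
    and d: "\<And>s. s \<in> {t..R} \<Longrightarrow> (f has_vector_derivative f' s) (at s within {t..R})"
    and c: "continuous_on {t..R} f'"
    and E: "integral {t..R} (\<lambda>s. (norm (f' s))\<^sup>2 * s\<^sup>2) \<le> E" "0 < E"
  shows "norm (f R - f t) \<le> sqrt (E / t)"
proof -
  \<comment> \<open>The pointwise Young inequality below splits |f'| with weight \<open>l\<close>.
    This choice makes the two resulting terms \<open>l / (2 * t)\<close> and
    \<open>E / (2 * l)\<close> equal and so recovers the Cauchy-Schwarz value
    \<open>sqrt (E / t)\<close>.\<close>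
  define l where "l = sqrt (E * t)"
  have l: "0 < l" "l * l = E * t" using t E by (auto simp: l_def)
  have c': "continuous_on {t..R} (\<lambda>s. (norm (f' s))\<^sup>2 * s\<^sup>2)" "continuous_on {t..R} (\<lambda>s. 1 / s\<^sup>2)"
    using t by (auto intro!: continuous_intros c)
  have "norm (f R - f t) \<le> integral {t..R} (\<lambda>s. l / 2 * (1 / s\<^sup>2) + 1 / (2 * l) * ((norm (f' s))\<^sup>2 * s\<^sup>2))"
  proof (rule norm_diff_le_integral_norm[OF t(2) d c])
    show "continuous_on {t..R} (\<lambda>s. l / 2 * (1 / s\<^sup>2) + 1 / (2 * l) * ((norm (f' s))\<^sup>2 * s\<^sup>2))"
      by (intro continuous_intros c')
    fix s assume s: "s \<in> {t..R}"
    with t have s0: "0 < s" by auto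
    have "0 \<le> (l / s - norm (f' s) * s)\<^sup>2 / (2 * l)" using l by simp
    also have "\<dots> = l / 2 * (1 / s\<^sup>2) + 1 / (2 * l) * ((norm (f' s))\<^sup>2 * s\<^sup>2) - norm (f' s)"
      using l s0 by (simp add: power2_eq_square field_simps)
    finally show "norm (f' s) \<le> l / 2 * (1 / s\<^sup>2) + 1 / (2 * l) * ((norm (f' s))\<^sup>2 * s\<^sup>2)" by simp
  qed
  also have "\<dots> = l / 2 * integral {t..R} (\<lambda>s. 1 / s\<^sup>2) + 1 / (2 * l) * integral {t..R} (\<lambda>s. (norm (f' s))\<^sup>2 * s\<^sup>2)"
    using c' by (subst integral_add) (auto intro!: integrable_continuous_interval continuous_intros simp del: times_divide_eq_left times_divide_eq_right)
  also have "\<dots> \<le> l / 2 * (1 / t) + 1 / (2 * l) * E"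
  proof -
    have "((\<lambda>s. 1 / s\<^sup>2) has_integral (- 1 / R - - 1 / t)) {t..R}"
    proof (rule fundamental_theorem_of_calculus[OF t(2)])
      fix s assume "s \<in> {t..R}"
      with t show "((\<lambda>s. - 1 / s) has_vector_derivative 1 / s\<^sup>2) (at s within {t..R})"
        unfolding has_real_derivative_iff_has_vector_derivative[symmetric]
        by (auto intro!: derivative_eq_intros simp: power2_eq_square)
    qed
    then have "integral {t..R} (\<lambda>s. 1 / s\<^sup>2) \<le> 1 / t"
      using t by (simp add: integral_unique)
    then show ?thesis using l E by (intro add_mono mult_left_mono) auto
  qed
  also have "\<dots> = l / t"
    using l t E by (simp add: field_simps)
  also have "\<dots> = sqrt (E / t)"
    using t E by (simp add: l_def real_sqrt_mult real_sqrt_divide field_simps)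
  finally show ?thesis .
qed

text \<open>The function (|f|^2 + e)^((p+2)/4) stands in for |f|^((p+2)/2): its base stays positive,
  so the chain rule for real powers applies even where f vanishes. The weight \<open>l\<close> is
  left free because its best value depends on a bound that will hold only for the limit of the
  integrals on the right.\<close>

lemma regularised_power_increment:
  fixes f :: "real \<Rightarrow> 'b::euclidean_space"
  assumes t: "0 < t" "t \<le> R"
    and d: "\<And>s. s \<in> {t..R} \<Longrightarrow> (f has_vector_derivative f' s) (at s within {t..R})"
    and c: "continuous_on {t..R} f'"
    and E: "integral {t..R} (\<lambda>s. (norm (f' s))\<^sup>2 * s\<^sup>2) \<le> E"
    and e: "0 < e" and l: "0 < l" and p: "0 \<le> p"
  shows "((norm (f t))\<^sup>2 + e) powr ((p + 2) / 4) \<le> ((norm (f R))\<^sup>2 + e) powr ((p + 2) / 4)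
     + (p + 2) / 2 / t\<^sup>2 * (l / 2 * integral {t..R} (\<lambda>s. ((norm (f s))\<^sup>2 + e) powr (p / 2) * s\<^sup>2) + E / (2 * l))"
proof -
  define g where "g s = ((norm (f s))\<^sup>2 + e) powr ((p + 2) / 4)" for s
  define g' where "g' s = (p + 2) / 4 * ((norm (f s))\<^sup>2 + e) powr ((p + 2) / 4 - 1) * (2 * (f s \<bullet> f' s))" for s
  define J where "J s = ((norm (f s))\<^sup>2 + e) powr (p / 2) * s\<^sup>2" for s
  define K where "K s = (norm (f' s))\<^sup>2 * s\<^sup>2" for s
  have cf: "continuous_on {t..R} f"
    using has_vector_derivative_continuous[OF d] by (simp add: continuous_on_eq_continuous_within)
  have pos: "0 < (norm (f s))\<^sup>2 + e" for s using e by (simp add: add_nonneg_pos)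
  then have nz: "(norm (f s))\<^sup>2 + e \<noteq> 0" for s by (metis less_irrefl)
  have cJ: "continuous_on {t..R} J" and cK: "continuous_on {t..R} K" and cg: "continuous_on {t..R} g'"
    unfolding J_def K_def g'_def using nz by (auto intro!: continuous_intros cf c)
  have "norm (g R - g t) \<le> integral {t..R} (\<lambda>s. (p + 2) / 2 / t\<^sup>2 * (l / 2 * J s + 1 / (2 * l) * K s))"
  proof (rule norm_diff_le_integral_norm[OF t(2)])
    show "continuous_on {t..R} g'" by fact
    show "continuous_on {t..R} (\<lambda>s. (p + 2) / 2 / t\<^sup>2 * (l / 2 * J s + 1 / (2 * l) * K s))"
      by (intro continuous_intros cJ cK)
    fix s assume s: "s \<in> {t..R}"
    with t have s0: "0 < s" "t \<le> s" by auto
    have "((\<lambda>s. f s \<bullet> f s) has_vector_derivative (2 * (f s \<bullet> f' s))) (at s within {t..R})"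
      using bounded_bilinear.has_vector_derivative[OF bounded_bilinear_inner d[OF s] d[OF s]]
      by (simp add: inner_commute)
    then have "((\<lambda>s. (norm (f s))\<^sup>2 + e) has_real_derivative (2 * (f s \<bullet> f' s))) (at s within {t..R})"
      unfolding has_real_derivative_iff_has_vector_derivative power2_norm_eq_inner
      by (auto intro!: derivative_eq_intros)
    from DERIV_chain2[OF has_real_derivative_powr[OF pos] this]
    show "(g has_vector_derivative g' s) (at s within {t..R})"
      unfolding has_real_derivative_iff_has_vector_derivative[symmetric] g_def g'_def .
    let ?w = "((norm (f s))\<^sup>2 + e) powr (p / 4)"
    have "norm (f s) \<le> ((norm (f s))\<^sup>2 + e) powr (1 / 2)"
      using e by (simp add: powr_half_sqrt real_le_rsqrt)
    then have "((norm (f s))\<^sup>2 + e) powr ((p + 2) / 4 - 1) * norm (f s)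
       \<le> ((norm (f s))\<^sup>2 + e) powr ((p + 2) / 4 - 1) * ((norm (f s))\<^sup>2 + e) powr (1 / 2)"
      by (intro mult_left_mono) auto
    also have "\<dots> = ?w"
      by (subst powr_add[symmetric]) (simp add: field_simps)
    finally have w: "((norm (f s))\<^sup>2 + e) powr ((p + 2) / 4 - 1) * norm (f s) \<le> ?w" .
    have w2: "?w\<^sup>2 = ((norm (f s))\<^sup>2 + e) powr (p / 2)"
      by (simp add: power2_eq_square powr_add[symmetric])
    have "norm (g' s) = (p + 2) / 2 * (((norm (f s))\<^sup>2 + e) powr ((p + 2) / 4 - 1) * \<bar>f s \<bullet> f' s\<bar>)"
      using p by (simp add: g'_def abs_mult)
    also have "\<dots> \<le> (p + 2) / 2 * (((norm (f s))\<^sup>2 + e) powr ((p + 2) / 4 - 1) * (norm (f s) * norm (f' s)))"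
      using p by (intro mult_left_mono Cauchy_Schwarz_ineq2) auto
    also have "\<dots> \<le> (p + 2) / 2 * (?w * norm (f' s))"
      using p mult_right_mono[OF w, of "norm (f' s)"] by (intro mult_left_mono) (auto simp: mult_ac)
    \<comment> \<open>The factor t^(-2) of the estimate is gained here: s^2 / t^2 \<ge> 1 on [t, R],
      so the three-dimensional weight s^2 may be inserted.\<close>
    also have "\<dots> \<le> (p + 2) / 2 * (s\<^sup>2 / t\<^sup>2 * (?w * norm (f' s)))"
    proof -
      have "1 \<le> s\<^sup>2 / t\<^sup>2" using t s0 by (simp add: power_mono)
      then show ?thesis
        using mult_right_mono[of 1 "s\<^sup>2 / t\<^sup>2" "?w * norm (f' s)"] p by (intro mult_left_mono) auto
    qed
    also have "\<dots> = (p + 2) / 2 / t\<^sup>2 * (s\<^sup>2 * (?w * norm (f' s)))" by simp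
    also have "\<dots> \<le> (p + 2) / 2 / t\<^sup>2 * (s\<^sup>2 * (l / 2 * ?w\<^sup>2 + 1 / (2 * l) * (norm (f' s))\<^sup>2))"
    proof -
      have "0 \<le> (l * ?w - norm (f' s))\<^sup>2 / (2 * l)" using l by simp
      also have "\<dots> = l / 2 * ?w\<^sup>2 + 1 / (2 * l) * (norm (f' s))\<^sup>2 - ?w * norm (f' s)"
        using l by (simp add: power2_eq_square field_simps)
      finally show ?thesis using p by (intro mult_left_mono) auto
    qed
    also have "\<dots> = (p + 2) / 2 / t\<^sup>2 * (l / 2 * J s + 1 / (2 * l) * K s)"
      unfolding J_def K_def w2 by (simp add: algebra_simps)
    finally show "norm (g' s) \<le> (p + 2) / 2 / t\<^sup>2 * (l / 2 * J s + 1 / (2 * l) * K s)" .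
  qed
  also have "\<dots> = (p + 2) / 2 / t\<^sup>2 * (l / 2 * integral {t..R} J + 1 / (2 * l) * integral {t..R} K)"
    unfolding integral_mult_right using cJ cK
    by (subst integral_add) (auto intro!: integrable_continuous_interval continuous_intros simp del: times_divide_eq_left times_divide_eq_right)
  also have "\<dots> \<le> (p + 2) / 2 / t\<^sup>2 * (l / 2 * integral {t..R} J + 1 / (2 * l) * E)"
    using E l p by (intro mult_left_mono add_left_mono) (auto simp: K_def[abs_def])
  finally show ?thesis by (simp add: g_def J_def[abs_def] abs_le_iff)
qed

section \<open>Energy bounds on the half-line and almost everywhere limits\<close>

lemma integral_le_nn_integral:
  fixes g :: "real \<Rightarrow> real"
  assumes c: "continuous_on {a..b} g" and g: "\<And>s. 0 \<le> g s" and S: "{a..b} \<subseteq> S"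
    and le: "(\<integral>\<^sup>+s. ennreal (g s) * indicator S s \<partial>lborel) \<le> ennreal E" "0 \<le> E"
  shows "integral {a..b} g \<le> E"
proof -
  have "(\<integral>\<^sup>+s. indicator {a..b} s * g s \<partial>lborel) = ennreal (integral {a..b} g)"
    by (rule nn_integral_has_integral_lebesgue[OF g integrable_integral[OF integrable_continuous_interval[OF c]]])
  then have "ennreal (integral {a..b} g) = (\<integral>\<^sup>+s. ennreal (indicator {a..b} s * g s) \<partial>lborel)" by simp
  also have "\<dots> \<le> (\<integral>\<^sup>+s. ennreal (g s) * indicator S s \<partial>lborel)"
    using S by (intro nn_integral_mono) (auto simp: indicator_def)
  also note le(1)
  finally show ?thesis using le(2) by simp
qed

lemma weighted_energy_decay:
  fixes f :: "real \<Rightarrow> 'b::euclidean_space"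
  assumes d: "\<And>s. (f has_vector_derivative f' s) (at s)"
    and c: "continuous_on UNIV f'"
    and v: "\<exists>R. \<forall>s\<ge>R. f s = 0"
    and E: "(\<integral>\<^sup>+s. ennreal ((norm (f' s))\<^sup>2 * s\<^sup>2) * indicator {0<..} s \<partial>lborel) \<le> ennreal E" "0 < E"
    and t: "0 < t"
  shows "norm (f t) \<le> sqrt (E / t)"
proof -
  obtain R where R: "\<forall>s\<ge>R. f s = 0" using v by blast
  \<comment> \<open>\<open>max t R\<close> keeps the interval oriented when t already lies beyond
    the point from which f vanishes.\<close>
  have "norm (f (max t R) - f t) \<le> sqrt (E / t)"
  proof (rule weighted_energy_increment[OF t _ _ _ _ E(2)])
    show "integral {t..max t R} (\<lambda>s. (norm (f' s))\<^sup>2 * s\<^sup>2) \<le> E"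
      using E t by (intro integral_le_nn_integral[where S="{0<..}"])
        (auto intro!: continuous_intros continuous_on_subset[OF c])
  qed (auto intro!: has_vector_derivative_at_within[OF d] continuous_on_subset[OF c])
  then show ?thesis using R by simp
qed

text \<open>The bound \<open>P\<close> is asked only of the liminf of the p-integrands, and only
  beyond \<open>t0\<close>; the p-integrals of the single \<open>f n\<close> may be large. The
  liminf is measurable whatever \<open>F\<close> is and equals the integrand of \<open>F\<close>
  almost everywhere beyond \<open>t0\<close>. The energy, in contrast, is bounded uniformly on the
  whole half-line, and this controls the \<open>f n\<close> pointwise.\<close>

lemma
  fixes f f' :: "nat \<Rightarrow> real \<Rightarrow> 'b::euclidean_space"
  assumes t0: "0 \<le> t0"
    and d: "\<And>n s. (f n has_vector_derivative f' n s) (at s)"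
    and c: "\<And>n. continuous_on UNIV (f' n)"
    and v: "\<And>n. \<exists>R. \<forall>s\<ge>R. f n s = 0"
    and E: "\<And>n. (\<integral>\<^sup>+s. ennreal ((norm (f' n s))\<^sup>2 * s\<^sup>2) * indicator {0<..} s \<partial>lborel) \<le> ennreal E" "0 < E"
    and lim: "AE t in lborel. t0 < t \<longrightarrow> (\<lambda>n. f n t) \<longlonglongrightarrow> F t"
  shows AE_limit_weighted_decay: "AE t in lborel. t0 < t \<longrightarrow> norm (F t) \<le> sqrt (E / t)"
    and AE_limit_weighted_interpolation:
      "\<lbrakk>1 \<le> p; 0 < P;
        (\<integral>\<^sup>+s. liminf (\<lambda>n. ennreal (norm (f n s) powr p * s\<^sup>2)) * indicator {t0<..} s \<partial>lborel) \<le> ennreal P\<rbrakk>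
       \<Longrightarrow> AE t in lborel. t0 < t \<longrightarrow> t\<^sup>2 * norm (F t) powr ((p + 2) / 2) \<le> (p + 2) / 2 * sqrt (P * E)"
proof -
  have bd: "norm (f n t) \<le> sqrt (E / t)" if "0 < t" for n t
    by (rule weighted_energy_decay[OF d c v E that])
  show "AE t in lborel. t0 < t \<longrightarrow> norm (F t) \<le> sqrt (E / t)"
    using lim
  proof eventually_elim
    case (elim t)
    show ?case
    proof
      assume "t0 < t"
      with elim have "(\<lambda>n. norm (f n t)) \<longlonglongrightarrow> norm (F t)" by (auto intro: tendsto_norm)
      then show "norm (F t) \<le> sqrt (E / t)"
        using bd[of t] t0 \<open>t0 < t\<close> by (intro LIMSEQ_le_const2) auto
    qed
  qed
  assume p: "1 \<le> p" and P: "0 < P"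
    and Ple: "(\<integral>\<^sup>+s. liminf (\<lambda>n. ennreal (norm (f n s) powr p * s\<^sup>2)) * indicator {t0<..} s \<partial>lborel) \<le> ennreal P"
  \<comment> \<open>The weight for which \<open>l * P\<close> and \<open>E / l\<close> agree; both
    equal \<open>sqrt (P * E)\<close>.\<close>
  define l where "l = sqrt (E / P)"
  have l: "0 < l" using E P by (simp add: l_def)
  have cf: "continuous_on UNIV (f n)" for n
    using has_vector_derivative_continuous[OF d] by (simp add: continuous_on_eq_continuous_within)
  have [measurable]: "f n \<in> borel_measurable borel" for n
    by (rule borel_measurable_continuous_onI[OF cf])
  \<comment> \<open>The regularisation fades along the sequence, and \<open>e n \<le> 1\<close>
    keeps the dominating constant below independent of n.\<close>
  define e where "e n = inverse (real (Suc n))" for n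
  have e: "e \<longlonglongrightarrow> 0" "0 < e n" "e n \<le> 1" for n
    using LIMSEQ_inverse_real_of_nat by (auto simp: e_def[abs_def] field_simps)
  have sq: "(norm (f n t))\<^sup>2 \<le> E / t" if "0 < t" for n t
    using bd[OF that, of n] E(2) that by (smt (verit) divide_pos_pos norm_ge_zero power_mono real_sqrt_pow2)
  have powr_half_sq: "((norm z)\<^sup>2) powr (a / 2) = norm z powr a" for z :: 'b and a
    by (simp add: powr_powr flip: powr_numeral)
  have pos: "0 < (norm z)\<^sup>2 + e n" for z :: 'b and n
    using e(2) by (intro add_nonneg_pos) auto
  \<comment> \<open>A finite R permits dominated convergence with a constant majorant on [t, R]. The
    term in \<open>E / R\<close> is the boundary value at R, bounded by the decay estimate.\<close>
  have main: "norm (F t) powr ((p + 2) / 2) \<le> (E / R) powr ((p + 2) / 4) + (p + 2) / 2 / t\<^sup>2 * sqrt (P * E)"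
    if t: "t0 < t" "t \<le> R" and limt: "(\<lambda>n. f n t) \<longlonglongrightarrow> F t" for t R
  proof -
    have tp: "0 < t" "0 < R" using t t0 by auto
    define g where "g n s = ((norm (f n s))\<^sup>2 + e n) powr (p / 2) * s\<^sup>2" for n s
    define J where "J n = integral {t..R} (g n)" for n
    have nz: "(norm (f n s))\<^sup>2 + e n \<noteq> 0" for n s
      using e(2)[of n] by (metis add_nonneg_pos less_irrefl zero_le_power2)
    have cg: "continuous_on {t..R} (g n)" for n
      unfolding g_def using nz by (auto intro!: continuous_intros continuous_on_subset[OF cf])
    have [measurable]: "g n \<in> borel_measurable borel" for n unfolding g_def by measurable
    have Jnn: "ennreal (J n) = (\<integral>\<^sup>+s. ennreal (g n s) * indicator {t..R} s \<partial>lborel)" for n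
    proof -
      have "(\<integral>\<^sup>+s. indicator {t..R} s * g n s \<partial>lborel) = ennreal (J n)"
        unfolding J_def
        by (rule nn_integral_has_integral_lebesgue[OF _ integrable_integral[OF integrable_continuous_interval[OF cg]]])
          (simp add: g_def)
      moreover have "(\<integral>\<^sup>+s. indicator {t..R} s * g n s \<partial>lborel) = (\<integral>\<^sup>+s. ennreal (g n s) * indicator {t..R} s \<partial>lborel)"
        by (intro nn_integral_cong) (auto simp: indicator_def)
      ultimately show ?thesis by simp
    qed
    let ?u = "\<lambda>s. liminf (\<lambda>n. ennreal (norm (f n s) powr p * s\<^sup>2)) * indicator {t..R} s"
    have "(\<lambda>n. ennreal (J n)) \<longlonglongrightarrow> (\<integral>\<^sup>+s. ?u s \<partial>lborel)"
      unfolding Jnn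
    proof (rule nn_integral_dominated_convergence[where w="\<lambda>s. ennreal ((E / t + 1) powr (p / 2) * R\<^sup>2) * indicator {t..R} s"])
      show "AE s in lborel. ennreal (g n s) * indicator {t..R} s
          \<le> ennreal ((E / t + 1) powr (p / 2) * R\<^sup>2) * indicator {t..R} s" for n
      proof (intro AE_I2)
        fix s show "ennreal (g n s) * indicator {t..R} s \<le> ennreal ((E / t + 1) powr (p / 2) * R\<^sup>2) * indicator {t..R} s"
        proof (cases "s \<in> {t..R}")
          case True
          then have s: "0 < s" "t \<le> s" "s \<le> R" using tp by auto
          have "E / s \<le> E / t" using s tp E(2) by (simp add: frac_le)
          then have "(norm (f n s))\<^sup>2 + e n \<le> E / t + 1"
            using sq[OF s(1), of n] e(3)[of n] by simp
          then have "g n s \<le> (E / t + 1) powr (p / 2) * R\<^sup>2"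
            unfolding g_def using e(2)[of n] s p by (intro mult_mono powr_mono2 power_mono) (auto intro: add_nonneg_nonneg less_imp_le)
          then show ?thesis by (simp add: mult_right_mono ennreal_leI)
        qed simp
      qed
      show "(\<integral>\<^sup>+s. ennreal ((E / t + 1) powr (p / 2) * R\<^sup>2) * indicator {t..R} s \<partial>lborel) < \<infinity>"
        using t by (simp add: nn_integral_cmult_indicator ennreal_mult_less_top)
      show "AE s in lborel. (\<lambda>n. ennreal (g n s) * indicator {t..R} s) \<longlonglongrightarrow> ?u s"
        using lim
      proof eventually_elim
        case (elim s)
        show ?case
        proof (cases "s \<in> {t..R}")
          case True
          with elim t have ls: "(\<lambda>n. f n s) \<longlonglongrightarrow> F s" by auto
          have "(\<lambda>n. ennreal (norm (f n s) powr p * s\<^sup>2)) \<longlonglongrightarrow> ennreal (norm (F s) powr p * s\<^sup>2)"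
            using p by (intro tendsto_ennrealI tendsto_intros tendsto_powr' tendsto_norm ls) auto
          then have "liminf (\<lambda>n. ennreal (norm (f n s) powr p * s\<^sup>2)) = ennreal (norm (F s) powr p * s\<^sup>2)"
            by (simp add: lim_imp_Liminf)
          moreover have "(\<lambda>n. g n s) \<longlonglongrightarrow> ((norm (F s))\<^sup>2 + 0) powr (p / 2) * s\<^sup>2"
            unfolding g_def using p e(2)
            by (intro tendsto_intros tendsto_powr' ls e(1)) (auto simp: pos less_imp_le)
          moreover have "((norm (F s))\<^sup>2 + 0) powr (p / 2) = norm (F s) powr p"
            by (simp add: powr_half_sq)
          ultimately show ?thesis using True by (auto intro: tendsto_ennrealI)
        qed simp
      qed
    qed (measurable)
    moreover have Lle: "(\<integral>\<^sup>+s. ?u s \<partial>lborel) \<le> ennreal P"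
    proof (rule order_trans[OF _ Ple])
      show "(\<integral>\<^sup>+s. ?u s \<partial>lborel) \<le> (\<integral>\<^sup>+s. liminf (\<lambda>n. ennreal (norm (f n s) powr p * s\<^sup>2)) * indicator {t0<..} s \<partial>lborel)"
        using t by (intro nn_integral_mono mult_left_mono) (auto simp: indicator_def)
    qed
    \<comment> \<open>The limit of the \<open>J n\<close> lies below \<open>P\<close> although a
      single \<open>J n\<close> need not; this is where the bound on the liminf is used.\<close>
    ultimately obtain j where j: "(\<lambda>n. ennreal (J n)) \<longlonglongrightarrow> ennreal j" "j \<le> P" "0 \<le> j"
      using P by (cases "\<integral>\<^sup>+s. ?u s \<partial>lborel") (auto simp: top_unique)
    have J0: "0 \<le> J n" for n
      unfolding J_def by (intro integral_nonneg integrable_continuous_interval cg) (auto simp: g_def)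
    have Jj: "J \<longlonglongrightarrow> j" using j J0 by (simp add: tendsto_ennreal_iff)
    have "((norm (F t))\<^sup>2 + 0) powr ((p + 2) / 4) \<le> (E / R + 0) powr ((p + 2) / 4)
        + (p + 2) / 2 / t\<^sup>2 * (l / 2 * j + E / (2 * l))"
    proof (rule LIMSEQ_le)
      show "(\<lambda>n. ((norm (f n t))\<^sup>2 + e n) powr ((p + 2) / 4)) \<longlonglongrightarrow> ((norm (F t))\<^sup>2 + 0) powr ((p + 2) / 4)"
        using p e(2) by (intro tendsto_intros tendsto_powr' limt e(1)) (auto simp: pos less_imp_le)
      show "(\<lambda>n. (E / R + e n) powr ((p + 2) / 4) + (p + 2) / 2 / t\<^sup>2 * (l / 2 * J n + E / (2 * l)))
         \<longlonglongrightarrow> (E / R + 0) powr ((p + 2) / 4) + (p + 2) / 2 / t\<^sup>2 * (l / 2 * j + E / (2 * l))"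
        using p e(2) E(2) tp by (intro tendsto_intros tendsto_powr' e(1) Jj) auto
      have "((norm (f n t))\<^sup>2 + e n) powr ((p + 2) / 4)
         \<le> (E / R + e n) powr ((p + 2) / 4) + (p + 2) / 2 / t\<^sup>2 * (l / 2 * J n + E / (2 * l))" for n
      proof -
        have "((norm (f n t))\<^sup>2 + e n) powr ((p + 2) / 4) \<le> ((norm (f n R))\<^sup>2 + e n) powr ((p + 2) / 4)
           + (p + 2) / 2 / t\<^sup>2 * (l / 2 * integral {t..R} (\<lambda>s. ((norm (f n s))\<^sup>2 + e n) powr (p / 2) * s\<^sup>2) + E / (2 * l))"
        proof (rule regularised_power_increment[OF tp(1) t(2) _ _ _ e(2) l])
          show "integral {t..R} (\<lambda>s. (norm (f' n s))\<^sup>2 * s\<^sup>2) \<le> E"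
            using E(1)[of n] E(2) tp by (intro integral_le_nn_integral[where S="{0<..}"])
              (auto intro!: continuous_intros continuous_on_subset[OF c])
        qed (use p in \<open>auto intro!: has_vector_derivative_at_within[OF d] continuous_on_subset[OF c]\<close>)
        moreover have "((norm (f n R))\<^sup>2 + e n) powr ((p + 2) / 4) \<le> (E / R + e n) powr ((p + 2) / 4)"
          using sq[OF tp(2), of n] p e(2)[of n] by (intro powr_mono2) auto
        ultimately show ?thesis by (simp add: J_def g_def[abs_def])
      qed
      then show "\<exists>N. \<forall>n\<ge>N. ((norm (f n t))\<^sup>2 + e n) powr ((p + 2) / 4)
         \<le> (E / R + e n) powr ((p + 2) / 4) + (p + 2) / 2 / t\<^sup>2 * (l / 2 * J n + E / (2 * l))" by blast
    qed
    moreover have "((norm (F t))\<^sup>2 + 0) powr ((p + 2) / 4) = norm (F t) powr ((p + 2) / 2)"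
    proof -
      have "((norm (F t))\<^sup>2) powr ((p + 2) / 2 / 2) = norm (F t) powr ((p + 2) / 2)"
        by (simp only: powr_half_sq)
      then show ?thesis by simp
    qed
    moreover have "l / 2 * j + E / (2 * l) \<le> sqrt (P * E)"
    proof -
      have "l * P = sqrt (P * E)" "E / l = sqrt (P * E)"
        using E(2) P by (auto simp: l_def real_sqrt_mult real_sqrt_divide field_simps)
      moreover have "l / 2 * j \<le> l / 2 * P" using j l by (intro mult_left_mono) auto
      ultimately show ?thesis by simp
    qed
    then have "(p + 2) / 2 / t\<^sup>2 * (l / 2 * j + E / (2 * l)) \<le> (p + 2) / 2 / t\<^sup>2 * sqrt (P * E)"
      using p by (intro mult_left_mono) auto
    ultimately show ?thesis by simp
  qed
  show "AE t in lborel. t0 < t \<longrightarrow> t\<^sup>2 * norm (F t) powr ((p + 2) / 2) \<le> (p + 2) / 2 * sqrt (P * E)"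
    using lim
  proof eventually_elim
    case (elim t)
    show ?case
    proof
      assume t: "t0 < t"
      then have tp: "0 < t" using t0 by simp
      \<comment> \<open>Letting R run through the natural numbers removes the boundary term, because
        the exponent (p + 2) / 4 is positive.\<close>
      have "norm (F t) powr ((p + 2) / 2) \<le> 0 + (p + 2) / 2 / t\<^sup>2 * sqrt (P * E)"
      proof (rule LIMSEQ_le_const)
        have "((\<lambda>n. E / real n) \<longlongrightarrow> 0) sequentially"
          by (rule lim_const_over_n)
        then have "(\<lambda>n. (E / real n) powr ((p + 2) / 4)) \<longlonglongrightarrow> 0 powr ((p + 2) / 4)"
          using p E(2) by (intro tendsto_powr' tendsto_intros) auto
        then show "(\<lambda>n. (E / real n) powr ((p + 2) / 4) + (p + 2) / 2 / t\<^sup>2 * sqrt (P * E))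
          \<longlonglongrightarrow> 0 + (p + 2) / 2 / t\<^sup>2 * sqrt (P * E)" by (intro tendsto_intros) simp
        obtain N where N: "t \<le> real N" using real_arch_simple by blast
        show "\<exists>N. \<forall>n\<ge>N. norm (F t) powr ((p + 2) / 2) \<le> (E / real n) powr ((p + 2) / 4) + (p + 2) / 2 / t\<^sup>2 * sqrt (P * E)"
          using elim t N by (intro exI[of _ N] allI impI main) auto
      qed
      then show "t\<^sup>2 * norm (F t) powr ((p + 2) / 2) \<le> (p + 2) / 2 * sqrt (P * E)"
        using tp by (simp add: field_simps)
    qed
  qed
qed

section \<open>Integration along rays\<close>

lemma nn_integral_scaleR:
  fixes h :: "'a::euclidean_space \<Rightarrow> ennreal"
  assumes [measurable]: "h \<in> borel_measurable borel" and t: "0 < t"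
  shows "(\<integral>\<^sup>+z. h z \<partial>lborel) = ennreal (t ^ DIM('a)) * (\<integral>\<^sup>+y. h (t *\<^sub>R y) \<partial>lborel)"
proof -
  have "(\<integral>\<^sup>+z. h z \<partial>lborel) = (\<integral>\<^sup>+z. h z \<partial>density (distr lborel borel (\<lambda>x::'a. 0 + t *\<^sub>R x)) (\<lambda>_. \<bar>t\<bar>^DIM('a)))"
    using lborel_affine[of t "0::'a"] t by simp
  also have "\<dots> = ennreal (t ^ DIM('a)) * (\<integral>\<^sup>+y. h (t *\<^sub>R y) \<partial>lborel)"
    using t by (simp add: nn_integral_density nn_integral_distr nn_integral_cmult ennreal_power)
  finally show ?thesis .
qed

text \<open>The measure dt / t is invariant under scaling, so the value does not depend on
  \<open>a\<close>; this is the source of \<open>ln 2\<close> in the ray formula.\<close>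

lemma nn_integral_inverse_half:
  fixes a :: real
  assumes "0 < a"
  shows "(\<integral>\<^sup>+t. ennreal (1 / t) * indicator {a / 2<..<a} t \<partial>lborel) = ennreal (ln 2)"
proof -
  have "(\<integral>\<^sup>+t. ennreal (1 / t) * indicator {a / 2<..<a} t \<partial>lborel)
      = (\<integral>\<^sup>+t. ennreal (1 / t) * indicator {a / 2..a} t \<partial>lborel)"
  proof (rule nn_integral_cong_AE)
    show "AE t in lborel. ennreal (1 / t) * indicator {a / 2<..<a} t = ennreal (1 / t) * indicator {a / 2..a} t"
      using AE_lborel_singleton[of a] AE_lborel_singleton[of "a/2"]
      by eventually_elim (auto simp: indicator_def)
  qed
  also have "\<dots> = ennreal (ln a - ln (a / 2))"
    using assms
    by (intro nn_integral_FTC_Icc) (auto intro!: derivative_eq_intros simp: has_real_derivative_iff_has_vector_derivative[symmetric])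
  also have "\<dots> = ennreal (ln 2)"
    using assms by (simp add: ln_div)
  finally show ?thesis .
qed

text \<open>A form of polar coordinates with the shell in place of the sphere. For fixed t > 0 the
  substitution z = t y turns t^(n-1) dy into dz / t and the shell condition into |z|/2 < t < |z|.
  Every z other than the origin is therefore counted with the same weight, the integral of dt / t
  over that interval.\<close>

lemma nn_integral_rays:
  fixes h :: "'a::euclidean_space \<Rightarrow> ennreal"
  assumes [measurable]: "h \<in> borel_measurable borel"
  shows "(\<integral>\<^sup>+y. (\<integral>\<^sup>+t. h (t *\<^sub>R y) * ennreal (t ^ (DIM('a) - 1)) * indicator {0<..} t \<partial>lborel)
            * indicator {y. 1 < norm y \<and> norm y < 2} y \<partial>lborel)
         = ennreal (ln 2) * (\<integral>\<^sup>+z. h z \<partial>lborel)"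
proof -
  let ?A = "{y::'a. 1 < norm y \<and> norm y < 2}"
  have inner: "(\<integral>\<^sup>+y. h (t *\<^sub>R y) * ennreal (t ^ (DIM('a) - 1)) * indicator {0<..} t * indicator ?A y \<partial>lborel)
      = (\<integral>\<^sup>+z. h z * (ennreal (1 / t) * indicator {norm z / 2<..<norm z} t) \<partial>lborel)" for t :: real
  proof (cases "0 < t")
    case True
    have p: "t ^ DIM('a) * (1/t) = t ^ (DIM('a) - 1)"
      using True DIM_positive[where 'a='a] by (cases "DIM('a)") auto
    have "(\<integral>\<^sup>+z. h z * (ennreal (1 / t) * indicator {norm z / 2<..<norm z} t) \<partial>lborel)
      = ennreal (t ^ DIM('a)) * (\<integral>\<^sup>+y. h (t *\<^sub>R y) * (ennreal (1 / t) * indicator {norm (t *\<^sub>R y) / 2<..<norm (t *\<^sub>R y)} t) \<partial>lborel)"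
    proof (rule nn_integral_scaleR[OF _ True])
      \<comment> \<open>The indicator of an interval depending on z, taken at t, is read as the
        indicator of a fixed set, taken at z; in this form its measurability is visible.\<close>
      have "(\<lambda>z::'a. h z * (ennreal (1 / t) * indicator {z. norm z / 2 < t \<and> t < norm z} z)) \<in> borel_measurable borel"
        by measurable
      moreover have "(\<lambda>z::'a. h z * (ennreal (1 / t) * indicator {z. norm z / 2 < t \<and> t < norm z} z))
        = (\<lambda>z. h z * (ennreal (1 / t) * indicator {norm z / 2<..<norm z} t))"
        by (auto simp: fun_eq_iff indicator_def)
      ultimately show "(\<lambda>z. h z * (ennreal (1 / t) * indicator {norm z / 2<..<norm z} t)) \<in> borel_measurable borel"
        by (simp only:)
    qed
    also have "\<dots> = ennreal (t ^ DIM('a)) * (\<integral>\<^sup>+y. ennreal (1 / t) * (h (t *\<^sub>R y) * indicator ?A y) \<partial>lborel)"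
    proof -
      have "indicator {norm (t *\<^sub>R y) / 2<..<norm (t *\<^sub>R y)} t = (indicator ?A y :: ennreal)" for y :: 'a
        using True by (auto simp: indicator_def)
      then show ?thesis by (simp add: mult_ac)
    qed
    also have "\<dots> = ennreal (t ^ DIM('a)) * (ennreal (1 / t) * (\<integral>\<^sup>+y. h (t *\<^sub>R y) * indicator ?A y \<partial>lborel))"
      by (simp add: nn_integral_cmult)
    also have "\<dots> = ennreal (t ^ (DIM('a) - 1)) * (\<integral>\<^sup>+y. h (t *\<^sub>R y) * indicator ?A y \<partial>lborel)"
      using True by (simp only: mult.assoc[symmetric] ennreal_mult[symmetric] p less_imp_le zero_le_power zero_le_divide_1_iff)
    also have "\<dots> = (\<integral>\<^sup>+y. h (t *\<^sub>R y) * ennreal (t ^ (DIM('a) - 1)) * indicator {0<..} t * indicator ?A y \<partial>lborel)"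
      using True by (subst nn_integral_cmult[symmetric]) (auto intro!: nn_integral_cong simp: mult_ac)
    finally show ?thesis ..
  next
    case False
    have "indicator {norm z / 2<..<norm z} t = (0::ennreal)" for z :: 'a
      using False norm_ge_zero[of z] by (auto simp: indicator_def)
    with False show ?thesis by simp
  qed
  have "(\<integral>\<^sup>+y. (\<integral>\<^sup>+t. h (t *\<^sub>R y) * ennreal (t ^ (DIM('a) - 1)) * indicator {0<..} t \<partial>lborel) * indicator ?A y \<partial>lborel)
    = (\<integral>\<^sup>+y. \<integral>\<^sup>+t. h (t *\<^sub>R y) * ennreal (t ^ (DIM('a) - 1)) * indicator {0<..} t * indicator ?A y \<partial>lborel \<partial>lborel)"
    by (subst nn_integral_multc) auto
  also have "\<dots> = (\<integral>\<^sup>+t. \<integral>\<^sup>+y. h (t *\<^sub>R y) * ennreal (t ^ (DIM('a) - 1)) * indicator {0<..} t * indicator ?A y \<partial>lborel \<partial>lborel)"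
    by (rule lborel_pair.Fubini') simp
  also have "\<dots> = (\<integral>\<^sup>+t. \<integral>\<^sup>+z. h z * (ennreal (1 / t) * indicator {norm z / 2<..<norm z} t) \<partial>lborel \<partial>lborel)"
    by (simp only: inner)
  also have "\<dots> = (\<integral>\<^sup>+z. \<integral>\<^sup>+t. h z * (ennreal (1 / t) * indicator {norm z / 2<..<norm z} t) \<partial>lborel \<partial>lborel)"
  proof (rule lborel_pair.Fubini'[symmetric])
    have "(\<lambda>(t, z::'a). h z * (ennreal (1 / t) * indicator {(t, z). norm z / 2 < t \<and> t < norm z} (t, z)))
        \<in> borel_measurable (lborel \<Otimes>\<^sub>M lborel)"
      by measurable
    moreover have "(\<lambda>(t, z::'a). h z * (ennreal (1 / t) * indicator {(t, z). norm z / 2 < t \<and> t < norm z} (t, z)))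
      = (\<lambda>(t, z). h z * (ennreal (1 / t) * indicator {norm z / 2<..<norm z} t))"
      by (auto simp: fun_eq_iff indicator_def)
    ultimately show "(\<lambda>(t, z::'a). h z * (ennreal (1 / t) * indicator {norm z / 2<..<norm z} t))
        \<in> borel_measurable (lborel \<Otimes>\<^sub>M lborel)" by (simp only:)
  qed
  also have "\<dots> = (\<integral>\<^sup>+z. h z * ennreal (ln 2) \<partial>lborel)"
  proof (rule nn_integral_cong_AE)
    show "AE z::'a in lborel. (\<integral>\<^sup>+t. h z * (ennreal (1 / t) * indicator {norm z / 2<..<norm z} t) \<partial>lborel) = h z * ennreal (ln 2)"
      using AE_lborel_singleton[of 0]
      by (rule eventually_mono) (simp add: nn_integral_cmult nn_integral_inverse_half)
  qed
  also have "\<dots> = ennreal (ln 2) * (\<integral>\<^sup>+z. h z \<partial>lborel)"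
    by (subst nn_integral_multc) (auto simp: mult.commute)
  finally show ?thesis .
qed

section \<open>Null sets along rays and under the norm\<close>

lemma AE_lborel_null_setE:
  assumes "AE x in lborel. P x"
  obtains N where "N \<in> null_sets lborel" "N \<in> sets borel" "\<And>x. x \<notin> N \<Longrightarrow> P x"
proof -
  obtain N where "N \<in> null_sets lborel" "{x \<in> space lborel. \<not> P x} \<subseteq> N"
    using assms unfolding eventually_ae_filter by blast
  then show thesis using that[of N] by (auto simp: null_sets_def)
qed

text \<open>The ray formula is applied to the indicator of a Borel null set: the total vanishes,
  hence so do almost all inner integrals, and the weight t^(n-1) is positive for t > 0.\<close>

lemma AE_rays:
  fixes P :: "'a::euclidean_space \<Rightarrow> bool"
  assumes "AE z in lborel. P z"
  shows "AE y in lborel. 1 < norm y \<and> norm y < 2 \<longrightarrow> (AE t in lborel. 0 < t \<longrightarrow> P (t *\<^sub>R y))"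
proof -
  obtain N :: "'a set" where N: "N \<in> null_sets lborel" "N \<in> sets borel" "\<And>x. x \<notin> N \<Longrightarrow> P x"
    using AE_lborel_null_setE[OF assms] by metis
  note [measurable] = N(2)
  let ?G = "\<lambda>y::'a. \<integral>\<^sup>+t. indicator N (t *\<^sub>R y) * ennreal (t ^ (DIM('a) - 1)) * indicator {0<..} t \<partial>lborel"
  have "(\<integral>\<^sup>+y. ?G y * indicator {y. 1 < norm y \<and> norm y < 2} y \<partial>lborel) = 0"
    using N(1) by (subst nn_integral_rays) auto
  then have "AE y in lborel. ?G y * indicator {y. 1 < norm y \<and> norm y < 2} y = 0"
    by (subst (asm) nn_integral_0_iff_AE) auto
  then show ?thesis
  proof eventually_elim
    case (elim y)
    show ?case
    proof
      assume "1 < norm y \<and> norm y < 2"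
      with elim have "?G y = 0" by simp
      then have "AE t in lborel. indicator N (t *\<^sub>R y) * ennreal (t ^ (DIM('a) - 1)) * indicator {0<..} t = 0"
        by (subst (asm) nn_integral_0_iff_AE) auto
      then show "AE t in lborel. 0 < t \<longrightarrow> P (t *\<^sub>R y)"
      proof eventually_elim
        case (elim t)
        show ?case
        proof
          assume "0 < t"
          with elim have "indicator N (t *\<^sub>R y) = (0::ennreal)"
            by (metis ennreal_eq_0_iff greaterThan_iff indicator_simps(1) mult_eq_0_iff not_less zero_less_power zero_neq_one)
          then show "P (t *\<^sub>R y)" using N(3) by (metis indicator_simps(1) zero_neq_one)
        qed
      qed
    qed
  qed
qed

lemma AE_lborel_mult:
  fixes c :: real
  assumes "c \<noteq> 0" "AE x in lborel. P x"
  shows "AE x in lborel. P (c * x)"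
proof -
  obtain N :: "real set" where N: "N \<in> null_sets lborel" "N \<in> sets borel" "\<And>x. x \<notin> N \<Longrightarrow> P x"
    using AE_lborel_null_setE[OF assms(2)] by metis
  note [measurable] = N(2)
  have "AE x in lborel. (0 + c * x) \<notin> N"
    using AE_not_in[OF N(1)] by (intro AE_borel_affine assms(1)) auto
  then show ?thesis by (rule eventually_mono) (use N(3) in auto)
qed

text \<open>The reverse transfer, from radii to points. Along the ray through y the radius is |y| t,
  and scaling preserves null sets, so every inner integral of the ray formula vanishes for the
  indicator of the points whose norm lies in N.\<close>

lemma AE_lborel_norm:
  assumes "AE r in lborel. P r"
  shows "AE x::'a::euclidean_space in lborel. P (norm x)"
proof -
  obtain N :: "real set" where N: "N \<in> null_sets lborel" "N \<in> sets borel" "\<And>x. x \<notin> N \<Longrightarrow> P x"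
    using AE_lborel_null_setE[OF assms] by metis
  note [measurable] = N(2)
  define h :: "'a \<Rightarrow> ennreal" where "h z = indicator N (norm z)" for z
  have [measurable]: "h \<in> borel_measurable borel" unfolding h_def by measurable
  have "(\<integral>\<^sup>+t. h (t *\<^sub>R y) * ennreal (t ^ (DIM('a) - 1)) * indicator {0<..} t \<partial>lborel) = 0"
    if "1 < norm y" for y
  proof -
    have "AE t in lborel. norm y * t \<notin> N"
      using that by (intro AE_lborel_mult AE_not_in[OF N(1)]) auto
    then have "AE t in lborel. h (t *\<^sub>R y) * ennreal (t ^ (DIM('a) - 1)) * indicator {0<..} t = 0"
      by eventually_elim (auto simp: h_def indicator_def mult.commute)
    then show ?thesis by (subst nn_integral_0_iff_AE) auto
  qed
  then have "(\<integral>\<^sup>+y. (\<integral>\<^sup>+t. h (t *\<^sub>R y) * ennreal (t ^ (DIM('a) - 1)) * indicator {0<..} t \<partial>lborel)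
      * indicator {y. 1 < norm y \<and> norm y < 2} y \<partial>lborel) = (\<integral>\<^sup>+y. 0 \<partial>(lborel :: 'a measure))"
    by (intro nn_integral_cong) (auto simp: indicator_def)
  then have "ennreal (ln 2) * (\<integral>\<^sup>+z. h z \<partial>lborel) = 0"
    by (subst nn_integral_rays[symmetric]) auto
  then have "(\<integral>\<^sup>+z. h z \<partial>lborel) = 0" by (auto simp: ennreal_eq_0_iff)
  then have "AE z in lborel. h z = 0" by (subst (asm) nn_integral_0_iff_AE) auto
  then show ?thesis
    by eventually_elim (use N(3) in \<open>auto simp: h_def indicator_def split: if_splits\<close>)
qed

section \<open>Selection of one good ray\<close>

lemma measure_shell:
  defines "A \<equiv> {y :: 'a::euclidean_space. 1 < norm y \<and> norm y < 2}"
  shows "emeasure lborel A = ennreal (measure lborel A)" and "0 < measure lborel A"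
proof -
  have A: "open A" "bounded A"
    unfolding A_def by (auto intro!: open_Collect_conj open_Collect_less continuous_intros boundedI[of _ 2])
  then have [measurable]: "A \<in> sets borel" by simp
  have "A \<in> fmeasurable lborel"
    using emeasure_bounded_finite[OF A(2)] by (intro fmeasurableI) auto
  then show m: "emeasure lborel A = ennreal (measure lborel A)"
    by (rule emeasure_eq_measure2[symmetric, THEN sym])
  obtain b :: 'a where "b \<in> Basis" using nonempty_Basis by blast
  then have "(3/2) *\<^sub>R b \<in> A" by (auto simp: A_def)
  then have "A \<noteq> {}" by blast
  then have "\<not> negligible A" by (rule open_not_negligible[OF A(1)])
  then have "emeasure lborel A \<noteq> 0"
    by (metis (no_types, lifting) \<open>A \<in> sets borel\<close> negligible_iff_null_sets null_setsI null_sets_completionI sets_lborel)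
  then show "0 < measure lborel A" unfolding m by (simp add: ennreal_eq_0_iff not_le)
qed

text \<open>
  Any factor above 2 would do instead of 3: on the shell, the two averages compared with this
  constant below have total mass at most \<open>2 * ln 2\<close>.
\<close>

definition ray_constant :: "'a::euclidean_space itself \<Rightarrow> real" where
  "ray_constant _ = 3 * ln 2 / measure lborel {y::'a. 1 < norm y \<and> norm y < 2}"

lemma ray_constant_pos: "0 < ray_constant TYPE('a::euclidean_space)"
  unfolding ray_constant_def by (intro divide_pos_pos measure_shell(2)) simp

text \<open>The energy bound holds for every n, but the ray must not depend on n. Fatou bounds the
  shell integral of the liminf of the ray energies; a small liminf at y bounds infinitely many of
  these energies, whence the subsequence, which is chosen after the ray and may depend on
  it.\<close>

lemma exists_good_ray:
  fixes g :: "nat \<Rightarrow> 'a::euclidean_space \<Rightarrow> ennreal"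
  assumes meas [measurable]: "\<And>n. g n \<in> borel_measurable borel" "h \<in> borel_measurable borel"
    and EH: "0 < E" "0 < H"
    and gE: "\<And>n. (\<integral>\<^sup>+z. g n z \<partial>lborel) \<le> ennreal E" and hH: "(\<integral>\<^sup>+z. h z \<partial>lborel) \<le> ennreal H"
    and P: "AE z in lborel. P z"
  obtains y r where "1 < norm y" "norm y < 2" "strict_mono (r :: nat \<Rightarrow> nat)"
    "AE t in lborel. 0 < t \<longrightarrow> P (t *\<^sub>R y)"
    "\<And>n. (\<integral>\<^sup>+t. g (r n) (t *\<^sub>R y) * ennreal (t ^ (DIM('a) - 1)) * indicator {0<..} t \<partial>lborel)
        \<le> ennreal (ray_constant TYPE('a) * E)"
    "(\<integral>\<^sup>+t. h (t *\<^sub>R y) * ennreal (t ^ (DIM('a) - 1)) * indicator {0<..} t \<partial>lborel)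
        \<le> ennreal (ray_constant TYPE('a) * H)"
proof -
  let ?A = "{y::'a. 1 < norm y \<and> norm y < 2}"
  define m where "m = measure lborel ?A"
  have m: "emeasure lborel ?A = ennreal m" and m0: "0 < m"
    unfolding m_def by (rule measure_shell)+
  define K where "K = ray_constant TYPE('a)"
  have K: "0 < K" by (simp add: K_def ray_constant_pos)
  define G where "G n y = (\<integral>\<^sup>+t. g n (t *\<^sub>R y) * ennreal (t ^ (DIM('a) - 1)) * indicator {0<..} t \<partial>lborel)" for n y
  define I where "I y = (\<integral>\<^sup>+t. h (t *\<^sub>R y) * ennreal (t ^ (DIM('a) - 1)) * indicator {0<..} t \<partial>lborel)" for y
  have [measurable]: "G n \<in> borel_measurable borel" "I \<in> borel_measurable borel" for n
    unfolding G_def I_def by measurable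
  have IG: "(\<integral>\<^sup>+y. G n y * indicator ?A y \<partial>lborel) \<le> ennreal (ln 2 * E)" for n
    unfolding G_def nn_integral_rays[OF meas(1)] ennreal_mult[OF ln_ge_zero[OF one_le_numeral] less_imp_le[OF EH(1)]]
    by (intro mult_left_mono gE) simp
  have II: "(\<integral>\<^sup>+y. I y * indicator ?A y \<partial>lborel) \<le> ennreal (ln 2 * H)"
    unfolding I_def nn_integral_rays[OF meas(2)] ennreal_mult[OF ln_ge_zero[OF one_le_numeral] less_imp_le[OF EH(2)]]
    by (intro mult_left_mono hH) simp
  define L where "L y = liminf (\<lambda>n. G n y * indicator ?A y)" for y
  have [measurable]: "L \<in> borel_measurable borel" unfolding L_def by measurable
  have IL: "(\<integral>\<^sup>+y. L y \<partial>lborel) \<le> ennreal (ln 2 * E)"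
  proof -
    have "(\<integral>\<^sup>+y. L y \<partial>lborel) \<le> liminf (\<lambda>n. \<integral>\<^sup>+y. G n y * indicator ?A y \<partial>lborel)"
      unfolding L_def by (intro nn_integral_liminf) measurable
    also have "\<dots> \<le> liminf (\<lambda>n. ennreal (ln 2 * E))"
      using IG by (intro Liminf_mono always_eventually) auto
    finally show ?thesis by (simp add: Liminf_const)
  qed
  \<comment> \<open>Both quantities are divided by their bounds and added, so that one Markov
    estimate yields a ray that is good for the energies and for \<open>h\<close> at once. Each
    summand contributes at most \<open>ln 2\<close> to the integral.\<close>
  define Q where "Q y = L y * ennreal (1 / E) + I y * indicator ?A y * ennreal (1 / H)" for y
  have [measurable]: "Q \<in> borel_measurable borel" unfolding Q_def by measurable
  have IQ: "(\<integral>\<^sup>+y. Q y \<partial>lborel) \<le> ennreal (2 * ln 2)"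
  proof -
    have "(\<integral>\<^sup>+y. Q y \<partial>lborel)
       = (\<integral>\<^sup>+y. L y \<partial>lborel) * ennreal (1 / E) + (\<integral>\<^sup>+y. I y * indicator ?A y \<partial>lborel) * ennreal (1 / H)"
      unfolding Q_def by (subst nn_integral_add; (subst nn_integral_multc)?; simp add: nn_integral_multc)
    also have "\<dots> \<le> ennreal (ln 2 * E) * ennreal (1 / E) + ennreal (ln 2 * H) * ennreal (1 / H)"
      by (intro add_mono mult_right_mono IL II) auto
    also have "\<dots> = ennreal (ln 2 * E * (1 / E)) + ennreal (ln 2 * H * (1 / H))"
      using EH by (simp only: ennreal_mult zero_le_divide_1_iff less_imp_le mult_nonneg_nonneg ln_ge_zero one_le_numeral)
    also have "\<dots> = ennreal (2 * ln 2)"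
      using EH by (simp add: ennreal_plus[symmetric] del: ennreal_plus)
    finally show ?thesis .
  qed
  have "\<exists>y\<in>?A. (AE t in lborel. 0 < t \<longrightarrow> P (t *\<^sub>R y)) \<and> Q y < ennreal K"
  proof (rule ccontr)
    assume neg: "\<not> ?thesis"
    \<comment> \<open>Without a good ray, K would bound Q from below almost everywhere on the shell;
      integration then gives 3 ln 2 \<le> 2 ln 2.\<close>
    have "AE y in lborel. ennreal K * indicator ?A y \<le> Q y"
      using AE_rays[OF P]
    proof eventually_elim
      case (elim y)
      then show ?case using neg by (cases "y \<in> ?A") (auto simp: not_less)
    qed
    then have "(\<integral>\<^sup>+y. ennreal K * indicator ?A y \<partial>lborel) \<le> (\<integral>\<^sup>+y. Q y \<partial>lborel)"
      by (rule nn_integral_mono_AE)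
    also note IQ
    also have "(\<integral>\<^sup>+y. ennreal K * indicator ?A y \<partial>lborel) = ennreal (K * m)"
      using K m0 by (simp add: nn_integral_cmult_indicator m ennreal_mult)
    finally have "K * m \<le> 2 * ln 2" by simp
    then show False using m0 by (simp add: K_def ray_constant_def m_def)
  qed
  then obtain y where y: "y \<in> ?A" "AE t in lborel. 0 < t \<longrightarrow> P (t *\<^sub>R y)" "Q y < ennreal K" by blast
  have "I y * ennreal (1 / H) \<le> ennreal K"
    using y order_trans[OF _ less_imp_le[OF y(3)]] by (simp add: Q_def)
  then have "I y * ennreal (1 / H) * ennreal H \<le> ennreal K * ennreal H"
    by (rule mult_right_mono) simp
  moreover have H1: "ennreal (1 / H) * ennreal H = 1" and E1: "ennreal (1 / E) * ennreal E = 1"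
    using EH by (simp_all add: ennreal_mult[symmetric] del: ennreal_mult)
  ultimately have Iy: "I y \<le> ennreal (K * H)"
    using K EH by (simp add: mult.assoc ennreal_mult)
  have "L y * ennreal (1 / E) < ennreal K"
    using y(3) by (auto simp: Q_def intro: le_less_trans[rotated])
  then have "L y < ennreal (K * E)"
  proof -
    assume *: "L y * ennreal (1 / E) < ennreal K"
    have False if "ennreal (K * E) \<le> L y"
    proof -
      have "ennreal (K * E) * ennreal (1 / E) \<le> L y * ennreal (1 / E)"
        by (intro mult_right_mono that) simp
      moreover have "ennreal (K * E) * ennreal (1 / E) = ennreal K"
        using K EH by (subst ennreal_mult[symmetric]) auto
      ultimately show False using * by simp
    qed
    then show ?thesis by (auto simp: not_le[symmetric])
  qed
  then have "\<not> (\<forall>\<^sub>F n in sequentially. ennreal (K * E) \<le> G n y)"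
    using y(1) Liminf_bounded[of "ennreal (K * E)" "\<lambda>n. G n y" sequentially] by (auto simp: L_def)
  then have "\<forall>N. \<exists>n\<ge>N. G n y \<le> ennreal (K * E)"
    by (auto simp: eventually_sequentially not_le intro: less_imp_le)
  then have "infinite {n. G n y \<le> ennreal (K * E)}"
    by (simp add: infinite_nat_iff_unbounded_le)
  then obtain r :: "nat \<Rightarrow> nat" where "strict_mono r" "\<And>n. G (r n) y \<le> ennreal (K * E)"
    using infinite_enumerate by (metis mem_Collect_eq)
  then show thesis
    using y Iy that[of y r] unfolding G_def I_def K_def by simp
qed

section \<open>Integration on subsets\<close>

lemma borel_measurable_lebesgue_onI:
  "f \<in> borel_measurable borel \<Longrightarrow> f \<in> borel_measurable (lebesgue_on S)"
  by (intro measurable_restrict_space1 measurable_completion) simp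

lemma nn_integral_lebesgue_on:
  assumes "S \<in> sets lebesgue"
  shows "(\<integral>\<^sup>+x. f x \<partial>lebesgue_on S) = (\<integral>\<^sup>+x. f x * indicator S x \<partial>lborel)"
  using assms by (simp add: nn_integral_restrict_space nn_integral_completion)

lemma integrable_lebesgue_on_supported:
  fixes f :: "'a::euclidean_space \<Rightarrow> 'b::euclidean_space"
  assumes "S \<in> sets lebesgue" "\<And>x. x \<notin> S \<Longrightarrow> f x = 0" "integrable lborel f"
  shows "integrable (lebesgue_on S) f"
proof -
  have "(\<lambda>x. indicator S x *\<^sub>R f x) = f" using assms(2) by (auto simp: indicator_def fun_eq_iff)
  then show ?thesis
    using assms by (simp add: integrable_restrict_space integrable_completion)
qed

lemma integral_lebesgue_on_supported:
  fixes f :: "'a::euclidean_space \<Rightarrow> 'b::euclidean_space"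
  assumes "S \<in> sets lebesgue" "\<And>x. x \<notin> S \<Longrightarrow> f x = 0" "f \<in> borel_measurable borel"
  shows "(LINT x|lebesgue_on S. f x) = (LINT x|lborel. f x)"
proof -
  have "(\<lambda>x. indicator S x *\<^sub>R f x) = f" using assms(2) by (auto simp: indicator_def fun_eq_iff)
  then show ?thesis
    using assms by (simp add: integral_restrict_space integral_completion)
qed

lemma integrable_compact_support:
  fixes f :: "'a::euclidean_space \<Rightarrow> 'b::euclidean_space"
  assumes "compact K" "continuous_on UNIV f" "\<And>x. x \<notin> K \<Longrightarrow> f x = 0"
  shows "integrable lborel f"
proof -
  have "(\<lambda>x. indicator K x *\<^sub>R f x) = f" using assms(3) by (auto simp: indicator_def fun_eq_iff)
  then show ?thesis
    using borel_integrable_compact[OF assms(1) continuous_on_subset[OF assms(2)]] by simp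
qed

text \<open>Elements of the completion are given as integrable on compact subsets; countably many of
  these cover the open set and assemble measurability on all of it.\<close>

lemma open_compact_exhaustion_measurable:
  fixes u :: "'a::euclidean_space \<Rightarrow> 'b::euclidean_space"
  assumes "open S" "\<And>K. compact K \<Longrightarrow> K \<subseteq> S \<Longrightarrow> u \<in> borel_measurable (lebesgue_on K)"
  shows "u \<in> borel_measurable (lebesgue_on S)"
proof -
  obtain C :: "nat \<Rightarrow> 'a set" where C: "\<And>n. compact (C n)" "\<And>n. C n \<subseteq> S" "\<Union>(range C) = S"
    using open_Union_compact_subsets[OF assms(1)] by metis
  show ?thesis
  proof (rule measurable_piecewise_restrict[where C="range C"])
    show "X \<inter> space (lebesgue_on S) \<in> sets (lebesgue_on S)" if X: "X \<in> range C" for X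
    proof -
      obtain n where "X = C n" using X by blast
      then show ?thesis
        using C(1)[of n] C(2)[of n] assms(1)
        by (subst sets_restrict_space_iff) (auto simp: Int_absorb1 Int_absorb2 compact_imp_closed)
    qed
    show "u \<in> borel_measurable (restrict_space (lebesgue_on S) X)" if X: "X \<in> range C" for X
    proof -
      obtain n where "X = C n" using X by blast
      then have "restrict_space (lebesgue_on S) X = lebesgue_on X"
        using C(1)[of n] C(2)[of n] assms(1) 
        by (subst restrict_restrict_space) (auto simp: Int_absorb1 Int_absorb2 compact_imp_closed)
      then show ?thesis using assms(2)[OF C(1) C(2)] \<open>X = C n\<close> by simp
    qed
  qed (use C(3) in auto)
qed

text \<open>Diagonal choice: the j-th error is below 2^(-j) on the j-th set of a compact exhaustion,
  so the cut-off errors are summable almost everywhere. Every point of S lies in all but finitely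
  many of these sets (\<open>Cex\<close> for a singleton), so the cut-off does not affect the
  limit.\<close>

lemma L1loc_AE_convergent_subsequence:
  fixes f :: "nat \<Rightarrow> 'a::euclidean_space \<Rightarrow> 'b::euclidean_space"
  assumes S: "open S" and cf: "\<And>n. continuous_on UNIV (f n)"
    and L1: "\<And>K. compact K \<Longrightarrow> K \<subseteq> S \<Longrightarrow> u \<in> Lp 1 K"
    and lim: "\<And>K. compact K \<Longrightarrow> K \<subseteq> S \<Longrightarrow> (\<lambda>n. Lp_norm 1 K (\<lambda>x. f n x - u x)) \<longlonglongrightarrow> 0"
  shows "\<exists>r. strict_mono r \<and> (AE x in lborel. x \<in> S \<longrightarrow> (\<lambda>n. f (r n) x) \<longlonglongrightarrow> u x)"
proof -
  obtain C :: "nat \<Rightarrow> 'a set" where C: "\<And>n. compact (C n)" "\<And>n. C n \<subseteq> S" "\<Union>(range C) = S"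
     and Cex: "\<And>K. compact K \<Longrightarrow> K \<subseteq> S \<Longrightarrow> \<exists>N. \<forall>n\<ge>N. K \<subseteq> C n"
    using open_Union_compact_subsets[OF S] by metis
  define d where "d j n = Lp_norm 1 (C j) (\<lambda>x. f n x - u x)" for j n
  have dlim: "\<forall>\<^sub>F n in sequentially. d j n < (1/2) ^ j" for j
    unfolding d_def using lim[OF C(1) C(2)] by (rule order_tendstoD) simp
  have "\<exists>r. \<forall>j. d j (r j) < (1/2) ^ j \<and> r j < r (Suc j)"
  proof (rule dependent_nat_choice)
    show "\<exists>n. d 0 n < (1/2) ^ 0" using eventually_happens[OF dlim[of 0]] by simp
    show "\<exists>y. d (Suc j) y < (1/2) ^ Suc j \<and> x < y" for x j
      using eventually_happens[OF eventually_conj[OF dlim[of "Suc j"] eventually_gt_at_top[of x]]] by simp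
  qed
  then obtain r where r: "\<And>j. d j (r j) < (1/2) ^ j" "\<And>j. r j < r (Suc j)" by blast
  have Cs: "C j \<in> sets lebesgue" for j
    using C(1) by (simp add: compact_imp_closed)
  define w where "w j x = norm (f (r j) x - u x) * indicator (C j) x" for j x
  have int: "integrable (lebesgue_on (C j)) (\<lambda>x. norm (f (r j) x - u x))" for j
  proof -
    have "integrable (lebesgue_on (C j)) (f (r j))"
    proof -
      have "integrable lborel (\<lambda>x. indicator (C j) x *\<^sub>R f (r j) x)"
        using C(1) continuous_on_subset[OF cf] by (intro borel_integrable_compact) auto
      then show ?thesis
        using Cs by (simp add: integrable_restrict_space integrable_completion)
    qed
    moreover have "integrable (lebesgue_on (C j)) u"
      using L1[OF C(1) C(2), of j] by (auto simp: Lp_def intro: integrable_norm_cancel)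
    ultimately show ?thesis by auto
  qed
  have wm: "(\<lambda>x. ennreal (w j x)) \<in> borel_measurable lebesgue" for j
  proof -
    have "(\<lambda>x. indicator (C j) x *\<^sub>R norm (f (r j) x - u x)) \<in> borel_measurable lebesgue"
      using borel_measurable_integrable[OF int[of j]] Cs by (subst (asm) borel_measurable_restrict_space_iff) auto
    then show ?thesis by (simp add: w_def mult.commute)
  qed
  have wI: "(\<integral>\<^sup>+x. ennreal (w j x) \<partial>lebesgue) \<le> ennreal ((1/2) ^ j)" for j
  proof -
    have "(\<integral>\<^sup>+x. ennreal (w j x) \<partial>lebesgue) = (\<integral>\<^sup>+x. ennreal (norm (f (r j) x - u x)) \<partial>lebesgue_on (C j))"
      using Cs by (subst nn_integral_restrict_space) (auto simp: w_def indicator_def intro!: nn_integral_cong)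
    also have "\<dots> = ennreal (d j (r j))"
      unfolding d_def Lp_norm_def using int[of j] by (subst nn_integral_eq_integral) (auto simp: integral_nonneg)
    finally show ?thesis using r(1)[of j] by (simp add: ennreal_leI)
  qed
  have "(\<integral>\<^sup>+x. (\<Sum>j. ennreal (w j x)) \<partial>lebesgue) = (\<Sum>j. \<integral>\<^sup>+x. ennreal (w j x) \<partial>lebesgue)"
    by (rule nn_integral_suminf[OF wm])
  also have "\<dots> \<le> (\<Sum>j. ennreal ((1/2) ^ j))"
    using wI by (intro suminf_le) auto
  also have "\<dots> = ennreal (\<Sum>j. (1/2) ^ j)"
    by (intro suminf_ennreal2) (auto intro: summable_geometric)
  also have "\<dots> < \<infinity>" by simp
  finally have fin: "(\<integral>\<^sup>+x. (\<Sum>j. ennreal (w j x)) \<partial>lebesgue) \<noteq> \<infinity>" by simp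
  have "AE x in lebesgue. (\<Sum>j. ennreal (w j x)) \<noteq> \<infinity>"
    using borel_measurable_suminf_order[OF wm] by (intro nn_integral_PInf_AE fin) auto
  then have "AE x in lborel. (\<Sum>j. ennreal (w j x)) \<noteq> \<infinity>" by (simp add: AE_completion_iff)
  then have "AE x in lborel. x \<in> S \<longrightarrow> (\<lambda>n. f (r n) x) \<longlonglongrightarrow> u x"
  proof eventually_elim
    case (elim x)
    show ?case
    proof
      assume "x \<in> S"
      then obtain N where N: "\<And>n. n \<ge> N \<Longrightarrow> x \<in> C n" using Cex[of "{x}"] by auto
      have "summable (\<lambda>j. w j x)"
        using elim by (intro summable_suminf_not_top) (auto simp: w_def)
      then have "(\<lambda>j. w j x) \<longlonglongrightarrow> 0" by (rule summable_LIMSEQ_zero)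
      moreover have "\<forall>\<^sub>F j in sequentially. w j x = norm (f (r j) x - u x)"
        unfolding eventually_sequentially w_def using N by (intro exI[of _ N]) simp
      ultimately have "(\<lambda>j. norm (f (r j) x - u x)) \<longlonglongrightarrow> 0"
        by (rule Lim_transform_eventually)
      then show "(\<lambda>n. f (r n) x) \<longlonglongrightarrow> u x"
        by (rule LIM_zero_cancel[OF tendsto_norm_zero_cancel])
    qed
  qed
  with r(2) show ?thesis by (auto simp: strict_mono_Suc_iff)
qed

section \<open>Test functions\<close>

lemma Ck_imp_differentiable: "Ck (Suc k) f \<Longrightarrow> f differentiable at x"
  by (simp add: differentiable_on_def)

lemma partial_eqI: "(f has_derivative f') (at x) \<Longrightarrow> partial i f x = f' (axis i 1)"
  unfolding partial_def using frechet_derivative_at by metis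

lemma Ck_has_derivative: "Ck (Suc k) f \<Longrightarrow> (f has_derivative frechet_derivative f (at x)) (at x)"
  using Ck_imp_differentiable frechet_derivative_works by blast

lemma partial_diff:
  assumes "Ck (Suc k) f" "Ck (Suc k) g"
  shows "partial i (\<lambda>x. f x - g x) = (\<lambda>x. partial i f x - partial i g x)"
proof
  fix x
  show "partial i (\<lambda>x. f x - g x) x = partial i f x - partial i g x"
    using partial_eqI[OF has_derivative_diff[OF Ck_has_derivative[OF assms(1)] Ck_has_derivative[OF assms(2)]]]
    by (simp add: partial_def)
qed

lemma Ck_diff: "Ck k f \<Longrightarrow> Ck k g \<Longrightarrow> Ck k (\<lambda>x. f x - g x)"
proof (induction k arbitrary: f g)
  case 0
  then show ?case by (simp add: continuous_on_diff)
next
  case (Suc k)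
  show ?case using Suc.IH Suc.prems by (simp add: partial_diff[OF Suc.prems])
qed

text \<open>Any compact set off which f vanishes can stand in for the closed support, so stability
  under differences and derivatives involves no computation of supports.\<close>

lemma test_functions_iff:
  "f \<in> test_functions S \<longleftrightarrow> (\<forall>k. Ck k f) \<and> (\<exists>K. compact K \<and> K \<subseteq> S \<and> (\<forall>x. x \<notin> K \<longrightarrow> f x = 0))"
proof -
  have "compact (closure {x. f x \<noteq> 0}) \<and> closure {x. f x \<noteq> 0} \<subseteq> S \<longleftrightarrow>
      (\<exists>K. compact K \<and> K \<subseteq> S \<and> (\<forall>x. x \<notin> K \<longrightarrow> f x = 0))" (is "?L \<longleftrightarrow> ?R")
  proof
    assume ?L
    then show ?R using closure_subset[of "{x. f x \<noteq> 0}"]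
      by (intro exI[of _ "closure {x. f x \<noteq> 0}"]) auto
  next
    assume ?R
    then obtain K where K: "compact K" "K \<subseteq> S" "\<forall>x. x \<notin> K \<longrightarrow> f x = 0" by blast
    then have "closure {x. f x \<noteq> 0} \<subseteq> K"
      by (intro closure_minimal compact_imp_closed) auto
    then show ?L using K compact_Int_closed[OF K(1), of "closure {x. f x \<noteq> 0}"]
      by (auto simp: Int_absorb1)
  qed
  then show ?thesis unfolding test_functions_def by simp
qed

lemma test_functions_Ck: "f \<in> test_functions S \<Longrightarrow> Ck k f"
  by (simp add: test_functions_def)

lemma test_functions_support:
  assumes "f \<in> test_functions S"
  obtains K where "compact K" "K \<subseteq> S" "\<And>x. x \<notin> K \<Longrightarrow> f x = 0"
  using assms unfolding test_functions_iff by blast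

lemma test_functions_eq_0: "f \<in> test_functions S \<Longrightarrow> x \<notin> S \<Longrightarrow> f x = 0"
  by (elim test_functions_support) blast

lemma test_functions_continuous: "f \<in> test_functions S \<Longrightarrow> continuous_on UNIV f"
  using test_functions_Ck[of f S 0] by simp

lemma test_functions_has_derivative:
  "f \<in> test_functions S \<Longrightarrow> (f has_derivative frechet_derivative f (at x)) (at x)"
  using Ck_has_derivative[OF test_functions_Ck] .

lemma test_functions_diff:
  assumes "f \<in> test_functions S" "g \<in> test_functions S"
  shows "(\<lambda>x. f x - g x) \<in> test_functions S"
proof -
  obtain K where K: "compact K" "K \<subseteq> S" "\<And>x. x \<notin> K \<Longrightarrow> f x = 0"
    using test_functions_support[OF assms(1)] by metis
  obtain L where L: "compact L" "L \<subseteq> S" "\<And>x. x \<notin> L \<Longrightarrow> g x = 0"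
    using test_functions_support[OF assms(2)] by metis
  have "compact (K \<union> L) \<and> K \<union> L \<subseteq> S \<and> (\<forall>x. x \<notin> K \<union> L \<longrightarrow> f x - g x = 0)"
    using K L by auto
  moreover have "Ck k (\<lambda>x. f x - g x)" for k
    by (intro Ck_diff test_functions_Ck[OF assms(1)] test_functions_Ck[OF assms(2)])
  ultimately show ?thesis
    unfolding test_functions_iff by metis
qed

lemma partial_test_functions:
  assumes "f \<in> test_functions S"
  shows "partial i f \<in> test_functions S"
proof -
  obtain K where K: "compact K" "K \<subseteq> S" "\<And>x. x \<notin> K \<Longrightarrow> f x = 0"
    using test_functions_support[OF assms] by metis
  have "partial i f x = 0" if "x \<notin> K" for x
  proof -
    have "((\<lambda>x. 0) has_derivative (\<lambda>x. 0)) (at x)" by simp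
    then have "(f has_derivative (\<lambda>x. 0)) (at x)"
      by (rule has_derivative_transform_within_open[OF _ open_Compl[OF compact_imp_closed[OF K(1)]]])
        (use K that in auto)
    then show ?thesis by (simp add: partial_eqI)
  qed
  moreover have "Ck k (partial i f)" for k
    using test_functions_Ck[OF assms, of "Suc k"] by simp
  ultimately show ?thesis unfolding test_functions_iff using K by blast
qed

lemma grad_continuous: "f \<in> test_functions S \<Longrightarrow> continuous_on UNIV (grad f)"
  unfolding grad_def[abs_def]
  by (intro continuous_on_vec_lambda test_functions_continuous partial_test_functions)

lemma grad_eq_0: "f \<in> test_functions S \<Longrightarrow> x \<notin> S \<Longrightarrow> grad f x = 0"
  by (simp add: grad_def vec_eq_iff test_functions_eq_0[OF partial_test_functions])

lemma grad_diff:
  assumes "f \<in> test_functions S" "g \<in> test_functions S"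
  shows "grad (\<lambda>x. f x - g x) x = grad f x - grad g x"
  using assms by (simp add: grad_def vec_eq_iff partial_diff[OF test_functions_Ck[of _ _ "Suc 0"] test_functions_Ck[of _ _ "Suc 0"]])

lemma power2_norm_grad: "(norm (grad f x))\<^sup>2 = (\<Sum>i\<in>UNIV. (norm (partial i f x))\<^sup>2)"
  by (simp add: grad_def norm_vec_def L2_set_def sum_nonneg)

lemma frechet_derivative_eq_sum_partial:
  assumes "f \<in> test_functions S"
  shows "frechet_derivative f (at x) y = (\<Sum>i\<in>UNIV. (y $ i) *\<^sub>R partial i f x)"
proof -
  let ?D = "frechet_derivative f (at x)"
  have lin: "linear ?D"
    using test_functions_has_derivative[OF assms] by (rule has_derivative_linear)
  have "?D y = ?D (\<Sum>i\<in>UNIV. (y $ i) *\<^sub>R axis i 1)"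
    using basis_expansion[of y] by (simp add: scalar_mult_eq_scaleR)
  then show ?thesis
    by (simp add: linear_sum[OF lin] linear_scale[OF lin] partial_def o_def)
qed

lemma norm_frechet_derivative_le:
  assumes "f \<in> test_functions S"
  shows "norm (frechet_derivative f (at x) y) \<le> norm y * norm (grad f x)"
proof -
  have "norm (frechet_derivative f (at x) y) \<le> (\<Sum>i\<in>UNIV. \<bar>y $ i\<bar> * \<bar>norm (partial i f x)\<bar>)"
    unfolding frechet_derivative_eq_sum_partial[OF assms] by (simp add: sum_norm_le)
  also have "\<dots> \<le> L2_set (($) y) UNIV * L2_set (\<lambda>i. norm (partial i f x)) UNIV"
    by (rule L2_set_mult_ineq)
  also have "\<dots> = norm y * norm (grad f x)"
    by (simp add: norm_vec_def grad_def L2_set_def)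
  finally show ?thesis .
qed

section \<open>Integration by parts\<close>

text \<open>By translation invariance of Lebesgue measure every difference quotient of f in
  direction v has integral zero, and dominated convergence carries this over to the
  derivative.\<close>

lemma integral_directional_derivative_eq_0:
  fixes f :: "'a::euclidean_space \<Rightarrow> 'b::euclidean_space"
  assumes d: "\<And>x. (f has_derivative f' x) (at x)"
    and c: "continuous_on UNIV (\<lambda>x. f' x v)"
    and K: "compact K" "\<And>x. x \<notin> K \<Longrightarrow> f x = 0" "\<And>x. x \<notin> K \<Longrightarrow> f' x v = 0"
  shows "(LINT x|lborel. f' x v) = 0"
proof -
  have cf: "continuous_on UNIV f"
    using has_derivative_continuous[OF d] by (simp add: continuous_on_eq_continuous_within)
  have [measurable]: "f \<in> borel_measurable borel" "(\<lambda>x. f' x v) \<in> borel_measurable borel"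
    using cf c by (auto intro: borel_measurable_continuous_onI)
  obtain M0 where M0: "\<And>x. x \<in> K \<Longrightarrow> norm (f' x v) \<le> M0"
    using compact_imp_bounded[OF compact_continuous_image[OF continuous_on_subset[OF c] K(1)]]
    by (auto simp: bounded_iff)
  define M where "M = max M0 0"
  have M: "norm (f' x v) \<le> M" "0 \<le> M" for x
    using M0[of x] K(3)[of x] by (cases "x \<in> K") (auto simp: M_def)
  \<comment> \<open>This bounds all difference quotients by M, uniformly in the step length.\<close>
  have incr: "norm (f (x + s *\<^sub>R v) - f x) \<le> M * s" if "0 \<le> s" for x s
  proof -
    have "norm (f (x + s *\<^sub>R v) - f (x + 0 *\<^sub>R v)) \<le> integral {0..s} (\<lambda>_. M)"
    proof (rule norm_diff_le_integral_norm[OF that, of "\<lambda>s. f (x + s *\<^sub>R v)" "\<lambda>s. f' (x + s *\<^sub>R v) v"])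
      fix r
      have "((\<lambda>s. x + s *\<^sub>R v) has_vector_derivative v) (at r within {0..s})"
        by (auto intro!: derivative_eq_intros)
      from vector_derivative_diff_chain_within[OF this has_derivative_at_withinI[OF d]]
      show "((\<lambda>s. f (x + s *\<^sub>R v)) has_vector_derivative f' (x + r *\<^sub>R v) v) (at r within {0..s})"
        by (simp add: o_def)
    qed (use M in \<open>auto intro!: continuous_on_compose2[OF c] continuous_intros\<close>)
    then show ?thesis using that by (simp add: mult.commute)
  qed
  obtain B where B: "\<And>x. x \<in> K \<Longrightarrow> norm x \<le> B" "0 < B"
    using compact_imp_bounded[OF K(1)] by (metis bounded_pos)
  \<comment> \<open>The radius is enlarged by |v| so that outside this ball neither x nor any
    translate x + v/(n+1) lies in K.\<close>
  let ?L = "cball (0::'a) (B + norm v)"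
  define h where "h n x = real (Suc n) *\<^sub>R (f (x + inverse (real (Suc n)) *\<^sub>R v) - f x)" for n x
  have [measurable]: "h n \<in> borel_measurable borel" for n unfolding h_def by measurable
  have "(\<lambda>n. LINT x|lborel. h n x) \<longlonglongrightarrow> (LINT x|lborel. f' x v)"
  proof (rule integral_dominated_convergence[where w="\<lambda>x. indicator ?L x *\<^sub>R M"])
    show "integrable lborel (\<lambda>x. indicator ?L x *\<^sub>R M)"
      by (rule borel_integrable_compact) auto
    show "AE x in lborel. (\<lambda>n. h n x) \<longlonglongrightarrow> f' x v"
    proof (intro AE_I2)
      fix x
      have "((\<lambda>s. x + s *\<^sub>R v) has_vector_derivative v) (at 0)"
        by (auto intro!: derivative_eq_intros)
      from vector_derivative_diff_chain_within[OF this has_derivative_at_withinI[OF d]]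
      have "((\<lambda>s. f (x + s *\<^sub>R v)) has_vector_derivative f' x v) (at 0)"
        by (simp add: o_def)
      then have "((\<lambda>s. norm (f (x + s *\<^sub>R v) - f x - s *\<^sub>R f' x v) / norm s) \<longlongrightarrow> 0) (at 0)"
        by (simp add: has_vector_derivative_def has_derivative_at)
      then have "((\<lambda>s. norm ((f (x + s *\<^sub>R v) - f x) /\<^sub>R s - f' x v)) \<longlongrightarrow> 0) (at 0)"
      proof (rule Lim_transform_eventually)
        have "norm (a - s *\<^sub>R b) / norm s = norm (a /\<^sub>R s - b)" if "s \<noteq> 0" for a b :: 'b and s :: real
        proof -
          have "a /\<^sub>R s - b = (a - s *\<^sub>R b) /\<^sub>R s" using that by (simp add: scaleR_diff_right)
          then show ?thesis by (simp add: divide_inverse mult.commute)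
        qed
        then show "\<forall>\<^sub>F s in at 0. norm (f (x + s *\<^sub>R v) - f x - s *\<^sub>R f' x v) / norm s
            = norm ((f (x + s *\<^sub>R v) - f x) /\<^sub>R s - f' x v)"
          by (auto simp: eventually_at_filter)
      qed
      then have "((\<lambda>s. (f (x + s *\<^sub>R v) - f x) /\<^sub>R s) \<longlongrightarrow> f' x v) (at 0)"
        by (rule LIM_zero_cancel[OF tendsto_norm_zero_cancel])
      moreover have "filterlim (\<lambda>n. inverse (real (Suc n))) (at 0) sequentially"
        using LIMSEQ_inverse_real_of_nat by (simp add: filterlim_at)
      ultimately have "(\<lambda>n. (f (x + inverse (real (Suc n)) *\<^sub>R v) - f x) /\<^sub>R inverse (real (Suc n))) \<longlonglongrightarrow> f' x v"
        by (rule filterlim_compose)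
      then show "(\<lambda>n. h n x) \<longlonglongrightarrow> f' x v"
        unfolding h_def by (simp only: inverse_inverse_eq)
    qed
    show "AE x in lborel. norm (h n x) \<le> indicator ?L x *\<^sub>R M" for n
    proof (intro AE_I2)
      fix x
      show "norm (h n x) \<le> indicator ?L x *\<^sub>R M"
      proof (cases "x \<in> ?L")
        case True
        have "norm (h n x) \<le> real (Suc n) * (M * inverse (real (Suc n)))"
          unfolding h_def using incr[of "inverse (real (Suc n))" x] by (simp del: of_nat_Suc add: mult_left_mono)
        also have "\<dots> = M" by (simp del: of_nat_Suc)
        finally show ?thesis using True by simp
      next
        case False
        have "norm (inverse (real (Suc n)) *\<^sub>R v) \<le> norm v"
          using mult_right_mono[of "inverse (real (Suc n))" 1 "norm v"] by (simp add: inverse_le_1_iff del: of_nat_Suc)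
        moreover have "norm x \<le> norm (x + inverse (real (Suc n)) *\<^sub>R v) + norm (inverse (real (Suc n)) *\<^sub>R v)"
          by (metis add_diff_cancel_right' norm_triangle_ineq4)
        ultimately have "B < norm x" "B < norm (x + inverse (real (Suc n)) *\<^sub>R v)"
          using False norm_ge_zero[of v] unfolding mem_cball_0 by linarith+
        then have "x \<notin> K" "x + inverse (real (Suc n)) *\<^sub>R v \<notin> K"
          using B(1) leD by blast+
        then show ?thesis using K False by (simp add: h_def)
      qed
    qed
  qed measurable
  moreover have "(LINT x|lborel. h n x) = 0" for n
  proof -
    have i: "integrable lborel f" by (rule integrable_compact_support[OF K(1) cf K(2)])
    define w where "w = inverse (real (Suc n)) *\<^sub>R v"
    have "(\<lambda>x. x + w) = (+) w" by (simp add: fun_eq_iff add.commute)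
    then have d: "distr lborel borel (\<lambda>x. x + w) = lborel"
      using lborel_distr_plus[of w] by simp
    have i2: "integrable lborel (\<lambda>x. f (x + w))"
      using integrable_distr_eq[of "\<lambda>x. x + w" lborel borel f] i d by simp
    have eq: "(LINT x|lborel. f x) = (LINT x|lborel. f (x + w))"
      using integral_distr[of "\<lambda>x. x + w" lborel borel f] d by simp
    show ?thesis unfolding h_def w_def[symmetric] using i i2 eq by (simp del: of_nat_Suc)
  qed
  ultimately show ?thesis by (simp add: LIMSEQ_const_iff)
qed

text \<open>The derivative of f times the conjugate of g integrates to zero, and the product rule
  splits it into the two sides.\<close>

lemma test_functions_integration_by_parts:
  assumes f: "f \<in> test_functions S" and g: "g \<in> test_functions S"
  shows "(LINT x|lborel. partial i f x * cnj (g x)) = - (LINT x|lborel. f x * cnj (partial i g x))"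
proof -
  obtain K where K: "compact K" "\<And>x. x \<notin> K \<Longrightarrow> f x = 0" using test_functions_support[OF f] by metis
  obtain L where L: "compact L" "\<And>x. x \<notin> L \<Longrightarrow> partial i f x = 0"
    using test_functions_support[OF partial_test_functions[OF f]] by metis
  note cont = test_functions_continuous[OF f] test_functions_continuous[OF g]
    test_functions_continuous[OF partial_test_functions[OF f]] test_functions_continuous[OF partial_test_functions[OF g]]
  let ?D = "\<lambda>x v. f x * cnj (frechet_derivative g (at x) v) + frechet_derivative f (at x) v * cnj (g x)"
  have "(LINT x|lborel. ?D x (axis i 1)) = 0"
  proof (rule integral_directional_derivative_eq_0[where f="\<lambda>x. f x * cnj (g x)" and K="K \<union> L"])
    show "((\<lambda>x. f x * cnj (g x)) has_derivative ?D x) (at x)" for x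
      by (intro has_derivative_mult has_derivative_cnj test_functions_has_derivative[OF f] test_functions_has_derivative[OF g])
    show "continuous_on UNIV (\<lambda>x. ?D x (axis i 1))"
      unfolding partial_def[symmetric] by (intro continuous_intros cont)
  qed (use K L in \<open>auto simp: partial_def[symmetric]\<close>)
  then have "(LINT x|lborel. f x * cnj (partial i g x) + partial i f x * cnj (g x)) = 0"
    by (simp add: partial_def)
  moreover have "integrable lborel (\<lambda>x. f x * cnj (partial i g x))"
    by (rule integrable_compact_support[OF K(1)]) (use K in \<open>auto intro!: continuous_intros cont\<close>)
  moreover have "integrable lborel (\<lambda>x. partial i f x * cnj (g x))"
    by (rule integrable_compact_support[OF L(1)]) (use L in \<open>auto intro!: continuous_intros cont\<close>)
  ultimately show ?thesis by (simp add: add_eq_0_iff)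
qed

section \<open>The square root of the Dirichlet Laplacian on test functions\<close>

lemma Lp_2I:
  assumes "S \<in> sets lebesgue" "compact K" "continuous_on UNIV f" "\<And>x. x \<notin> K \<Longrightarrow> f x = 0" "\<And>x. x \<notin> S \<Longrightarrow> f x = 0"
  shows "f \<in> Lp 2 S"
proof -
  have "integrable lborel (\<lambda>x. (norm (f x))\<^sup>2)"
    by (rule integrable_compact_support[OF assms(2)]) (use assms in \<open>auto intro!: continuous_intros\<close>)
  then have "integrable (lebesgue_on S) (\<lambda>x. (norm (f x))\<^sup>2)"
    using assms by (intro integrable_lebesgue_on_supported) auto
  then show ?thesis
    using borel_measurable_lebesgue_onI[OF borel_measurable_continuous_onI[OF assms(3)]]
    by (simp add: Lp_def)
qed

lemma test_functions_Lp_2: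
  assumes "S \<in> sets lebesgue" "f \<in> test_functions S"
  shows "f \<in> Lp 2 S"
  using test_functions_support[OF assms(2)] test_functions_eq_0[OF assms(2)]
    Lp_2I[OF assms(1) _ test_functions_continuous[OF assms(2)]] by metis

lemma grad_Lp_2:
  assumes "S \<in> sets lebesgue" "f \<in> test_functions S"
  shows "grad f \<in> Lp 2 S"
proof -
  have "\<forall>i. \<exists>K. compact K \<and> (\<forall>x. x \<notin> K \<longrightarrow> partial i f x = 0)"
    using test_functions_support[OF partial_test_functions[OF assms(2)]] by metis
  then obtain K where K: "\<And>i. compact (K i)" "\<And>i x. x \<notin> K i \<Longrightarrow> partial i f x = 0" by metis
  show ?thesis
  proof (rule Lp_2I[OF assms(1) _ grad_continuous[OF assms(2)]])
    show "compact (\<Union>i. K i)" using K(1) by (simp add: compact_UN)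
    show "grad f x = 0" if "x \<notin> (\<Union>i. K i)" for x
      using that K(2) by (auto simp: grad_def vec_eq_iff)
  qed (use assms grad_eq_0 in auto)
qed

section \<open>Norms and inner products in L^2\<close>

lemma Lp_norm_2_eq: "Lp_norm 2 S f = sqrt (LINT x|lebesgue_on S. (norm (f x))\<^sup>2)"
  by (simp add: Lp_norm_def powr_half_sqrt integral_nonneg)

lemma Lp_norm_2_nonneg: "0 \<le> Lp_norm 2 S f"
  by (simp add: Lp_norm_def)

lemma power2_Lp_norm_2: "(Lp_norm 2 S f)\<^sup>2 = (LINT x|lebesgue_on S. (norm (f x))\<^sup>2)"
  by (simp add: Lp_norm_2_eq integral_nonneg)

lemma L2_inner_self: "L2_inner S f f = of_real ((Lp_norm 2 S f)\<^sup>2)"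
  by (simp only: L2_inner_def complex_norm_square[symmetric] power2_Lp_norm_2 integral_complex_of_real)

text \<open>Applied below to a pair with Re <f, g> = |f|^2, where this Young inequality already
  yields |f| \<le> |g|.\<close>

lemma Re_L2_inner_le:
  assumes "f \<in> Lp 2 S" "g \<in> Lp 2 S"
  shows "2 * Re (L2_inner S f g) \<le> (Lp_norm 2 S f)\<^sup>2 + (Lp_norm 2 S g)\<^sup>2"
proof -
  have [measurable]: "f \<in> borel_measurable (lebesgue_on S)" "g \<in> borel_measurable (lebesgue_on S)"
    and i: "integrable (lebesgue_on S) (\<lambda>x. (norm (f x))\<^sup>2)" "integrable (lebesgue_on S) (\<lambda>x. (norm (g x))\<^sup>2)"
    using assms by (auto simp: Lp_def)
  have amgm: "2 * (a * b) \<le> a\<^sup>2 + b\<^sup>2" for a b :: real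
    using sum_squares_bound[of a b] by (simp add: mult.assoc)
  have "2 * Re (L2_inner S f g) \<le> 2 * norm (L2_inner S f g)"
    using complex_Re_le_cmod by simp
  also have "\<dots> \<le> 2 * (LINT x|lebesgue_on S. norm (f x) * norm (g x))"
    unfolding L2_inner_def
    using integral_norm_bound[of "lebesgue_on S" "\<lambda>x. f x * cnj (g x)"] by (simp add: norm_mult)
  also have "\<dots> = (LINT x|lebesgue_on S. 2 * (norm (f x) * norm (g x)))" by simp
  also have "\<dots> \<le> (LINT x|lebesgue_on S. (norm (f x))\<^sup>2 + (norm (g x))\<^sup>2)"
  proof (rule integral_mono_AE')
    show "integrable (lebesgue_on S) (\<lambda>x. (norm (f x))\<^sup>2 + (norm (g x))\<^sup>2)"
      using i by simp
  qed (auto simp: amgm)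
  also have "\<dots> = (Lp_norm 2 S f)\<^sup>2 + (Lp_norm 2 S g)\<^sup>2"
    using i by (simp add: power2_Lp_norm_2)
  finally show ?thesis .
qed

text \<open>The image of a test function is minus its classical Laplacian, found by moving the
  derivative off the second factor in each coordinate. The second claim is the same identity tested
  with f itself.\<close>

lemma neg_Dirichlet_Laplacian_test_functions:
  assumes S: "S \<in> sets lebesgue" and f: "f \<in> test_functions S"
  shows "(f, \<lambda>x. - (\<Sum>i\<in>UNIV. partial i (partial i f) x)) \<in> neg_Dirichlet_Laplacian S" (is "(f, ?L) \<in> _")
    and "L2_inner S (\<lambda>x. - (\<Sum>i\<in>UNIV. partial i (partial i f) x)) f = of_real ((Lp_norm 2 S (grad f))\<^sup>2)"
proof -
  note p = partial_test_functions
  have parts: "(LINT x|lebesgue_on S. (\<Sum>i\<in>UNIV. grad f x $ i * cnj (grad g x $ i))) = L2_inner S ?L g"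
    if g: "g \<in> test_functions S" for g
  proof -
    note cont = test_functions_continuous[OF p[OF f]] test_functions_continuous[OF p[OF g]]
       test_functions_continuous[OF p[OF p[OF f]]] test_functions_continuous[OF g]
    obtain K where K: "compact K" "\<And>x. x \<notin> K \<Longrightarrow> g x = 0" using test_functions_support[OF g] by metis
    have i1: "integrable lborel (\<lambda>x. partial i f x * cnj (partial i g x))" for i
    proof -
      obtain L where "compact L" "\<And>x. x \<notin> L \<Longrightarrow> partial i g x = 0" using test_functions_support[OF p[OF g]] by metis
      then show ?thesis
        by (intro integrable_compact_support[of L]) (auto intro!: continuous_intros cont)
    qed
    have i2: "integrable lborel (\<lambda>x. partial i (partial i f) x * cnj (g x))" for i
      by (rule integrable_compact_support[OF K(1)]) (use K in \<open>auto intro!: continuous_intros cont\<close>)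
    have "(LINT x|lebesgue_on S. (\<Sum>i\<in>UNIV. grad f x $ i * cnj (grad g x $ i)))
        = (LINT x|lborel. (\<Sum>i\<in>UNIV. partial i f x * cnj (partial i g x)))"
      unfolding grad_def
      by (subst integral_lebesgue_on_supported[OF S])
        (auto simp: test_functions_eq_0[OF p[OF g]] intro!: borel_measurable_continuous_onI continuous_intros cont)
    also have "\<dots> = (\<Sum>i\<in>UNIV. (LINT x|lborel. partial i f x * cnj (partial i g x)))"
      by (simp add: i1)
    also have "\<dots> = (\<Sum>i\<in>UNIV. - (LINT x|lborel. partial i (partial i f) x * cnj (g x)))"
      by (simp add: test_functions_integration_by_parts[OF p[OF f] g])
    also have "\<dots> = (LINT x|lborel. (\<Sum>i\<in>UNIV. - (partial i (partial i f) x * cnj (g x))))"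
      by (simp add: i2)
    also have "\<dots> = (LINT x|lborel. ?L x * cnj (g x))"
      by (simp add: sum_distrib_right sum_negf)
    also have "\<dots> = L2_inner S ?L g"
      unfolding L2_inner_def
      by (subst integral_lebesgue_on_supported[OF S])
        (auto simp: test_functions_eq_0[OF g] intro!: borel_measurable_continuous_onI continuous_intros cont)
    finally show ?thesis .
  qed
  have "\<forall>i. \<exists>K. compact K \<and> (\<forall>x. x \<notin> K \<longrightarrow> partial i (partial i f) x = 0)"
    using test_functions_support[OF p[OF p[OF f]]] by metis
  then obtain K where K: "\<And>i. compact (K i)" "\<And>i x. x \<notin> K i \<Longrightarrow> partial i (partial i f) x = 0" by metis
  have "?L \<in> Lp 2 S"
  proof (rule Lp_2I[OF S])
    show "compact (\<Union>i. K i)" using K(1) by (simp add: compact_UN)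
    show "continuous_on UNIV ?L"
      by (intro continuous_intros test_functions_continuous[OF p[OF p[OF f]]])
  qed (use K(2) test_functions_eq_0[OF p[OF p[OF f]]] in auto)
  \<comment> \<open>A test function is its own approximation: the constant sequence at f
    serves.\<close>
  moreover have "H10_grad S f (grad f)"
    unfolding H10_grad_def
    using f S by (auto intro!: test_functions_Lp_2 grad_Lp_2 exI[of _ "\<lambda>_. f"] simp: Lp_norm_def)
  ultimately show "(f, ?L) \<in> neg_Dirichlet_Laplacian S"
    unfolding neg_Dirichlet_Laplacian_def using parts by blast
  have "L2_inner S ?L f = (LINT x|lebesgue_on S. of_real ((norm (grad f x))\<^sup>2))"
    unfolding parts[OF f, symmetric] power2_norm_grad
    by (simp add: grad_def complex_norm_square[symmetric])
  then show "L2_inner S ?L f = of_real ((Lp_norm 2 S (grad f))\<^sup>2)"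
    by (simp only: integral_complex_of_real power2_Lp_norm_2)
qed

text \<open>The infimum ranges over the images of f under every square root, each given as a
  relation. Inside a root R, the factorisation \<open>R O R\<close> supplies an intermediate w with
  |w| = |grad f|. Any image s of f under the same R satisfies <w, s> = <?L, f> = <w, w> by symmetry,
  hence |w| \<le> |s|, so the infimum is attained at w.\<close>

lemma sqrt_Laplacian_norm_test_functions:
  assumes S: "S \<in> sets lebesgue" and f: "f \<in> test_functions S"
    and ne: "op_sqrt S (neg_Dirichlet_Laplacian S) \<noteq> {}"
  shows "sqrt_Laplacian_norm S f = ennreal (Lp_norm 2 S (grad f))"
proof -
  let ?L = "\<lambda>x. - (\<Sum>i\<in>UNIV. partial i (partial i f) x)"
  note L = neg_Dirichlet_Laplacian_test_functions[OF S f]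
  have adj: "L2_inner S h u = L2_inner S v g"
    if "nonneg_selfadjoint S T" "(u, g) \<in> T" "(v, h) \<in> T" for T u g v h
    using that unfolding nonneg_selfadjoint_def op_adjoint_def by blast
  have mem: "u \<in> Lp 2 S \<and> g \<in> Lp 2 S"
    if "nonneg_selfadjoint S T" "(u, g) \<in> T" for T u g
    using that unfolding nonneg_selfadjoint_def op_adjoint_def by blast
  have ex: "\<exists>w. (f, w) \<in> T \<and> (w, ?L) \<in> T \<and> Lp_norm 2 S w = Lp_norm 2 S (grad f)"
    if T: "nonneg_selfadjoint S T" "T O T = neg_Dirichlet_Laplacian S" for T
  proof -
    obtain w where w: "(f, w) \<in> T" "(w, ?L) \<in> T" using L(1)[folded T(2)] by (elim relcompEpair)
    have "of_real ((Lp_norm 2 S (grad f))\<^sup>2) = (of_real ((Lp_norm 2 S w)\<^sup>2) :: complex)"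
      using adj[OF T(1) w] L(2) by (simp only: L2_inner_self)
    then have "Lp_norm 2 S w = Lp_norm 2 S (grad f)"
      by (simp only: of_real_eq_iff) (simp add: Lp_norm_2_nonneg)
    with w show ?thesis by blast
  qed
  show ?thesis
  proof (rule antisym)
    obtain T where T: "nonneg_selfadjoint S T" "T O T = neg_Dirichlet_Laplacian S"
      using ne unfolding op_sqrt_def by blast
    from ex[OF T] obtain w where "(f, w) \<in> T" "Lp_norm 2 S w = Lp_norm 2 S (grad f)" by blast
    moreover from this(1) have "(f, w) \<in> op_sqrt S (neg_Dirichlet_Laplacian S)"
      using T unfolding op_sqrt_def by blast
    ultimately show "sqrt_Laplacian_norm S f \<le> ennreal (Lp_norm 2 S (grad f))"
      unfolding sqrt_Laplacian_norm_def by (metis (mono_tags, lifting) INF_lower mem_Collect_eq)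
    show "ennreal (Lp_norm 2 S (grad f)) \<le> sqrt_Laplacian_norm S f"
      unfolding sqrt_Laplacian_norm_def
    proof (rule INF_greatest)
      fix s assume "s \<in> {s. (f, s) \<in> op_sqrt S (neg_Dirichlet_Laplacian S)}"
      then obtain R where R: "nonneg_selfadjoint S R" "R O R = neg_Dirichlet_Laplacian S" "(f, s) \<in> R"
        unfolding op_sqrt_def by blast
      from ex[OF R(1,2)] obtain w where w: "(f, w) \<in> R" "(w, ?L) \<in> R" "Lp_norm 2 S w = Lp_norm 2 S (grad f)" by blast
      have "L2_inner S w s = L2_inner S w w"
        using adj[OF R(1) R(3) w(2)] adj[OF R(1) w(1) w(2)] by simp
      then have "Re (L2_inner S w s) = (Lp_norm 2 S w)\<^sup>2"
        by (simp only: L2_inner_self Re_complex_of_real)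
      moreover have "2 * Re (L2_inner S w s) \<le> (Lp_norm 2 S w)\<^sup>2 + (Lp_norm 2 S s)\<^sup>2"
        using mem[OF R(1) w(1)] mem[OF R(1) R(3)] by (intro Re_L2_inner_le) auto
      ultimately have "(Lp_norm 2 S w)\<^sup>2 \<le> (Lp_norm 2 S s)\<^sup>2" by simp
      then show "ennreal (Lp_norm 2 S (grad f)) \<le> ennreal (Lp_norm 2 S s)"
        using w(3) Lp_norm_2_nonneg by (auto intro!: ennreal_leI dest: power2_le_imp_le)
    qed
  qed
qed

section \<open>Radial profiles on the exterior domain\<close>

lemma mem_exterior [simp]: "x \<in> exterior \<longleftrightarrow> 1 < norm x"
  by (auto simp: exterior_def)

lemma open_exterior: "open exterior"
proof -
  have "exterior = - cball 0 1" by (auto simp: exterior_def)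
  then show ?thesis by (metis open_Compl closed_cball)
qed

lemma exterior_sets [simp, measurable]: "exterior \<in> sets lebesgue" "exterior \<in> sets borel"
  using open_exterior by auto

lemma AE_lebesgue_on_iff:
  "S \<in> sets lebesgue \<Longrightarrow> (AE x in lebesgue_on S. P x) \<longleftrightarrow> (AE x in lborel. x \<in> S \<longrightarrow> P x)"
  by (simp add: AE_restrict_space_iff AE_completion_iff)

lemma less_divide_imp_less_mult:
  fixes a t :: real
  shows "1 / a < t \<Longrightarrow> 1 < a \<Longrightarrow> 1 < a * t"
  by (simp add: field_simps)

text \<open>The parameter t on the ray through y corresponds to the radius |y| t, and the ray lies
  in the domain for t > 1 / |y|; the factor 4 in the energy comes from |y|^2 < 4. The function
  \<open>h\<close> is a slot for the p-integrand. Convergence is recorded for the full sequence as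
  well as for the subsequence \<open>f\<close>, since \<open>h\<close> may be built from the full
  one.\<close>

lemma good_ray_profile:
  fixes \<phi> :: "nat \<Rightarrow> real^3 \<Rightarrow> complex"
  assumes \<phi>: "\<And>n. \<phi> n \<in> test_functions exterior" and E: "0 < E"
    and gE: "\<And>n. (\<integral>\<^sup>+z. ennreal ((norm (grad (\<phi> n) z))\<^sup>2) \<partial>lborel) \<le> ennreal E"
    and lim: "AE x in lborel. x \<in> exterior \<longrightarrow> (\<lambda>n. \<phi> n x) \<longlonglongrightarrow> u x"
    and U: "radial_profile exterior u U"
    and h: "h \<in> borel_measurable borel" "0 < H" "(\<integral>\<^sup>+z. h z \<partial>lborel) \<le> ennreal H"
  defines "K \<equiv> ray_constant TYPE(real^3)"
  obtains y f f' where "1 < norm y" "norm y < 2"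
    "\<And>n s. (f n has_vector_derivative f' n s) (at s)" "\<And>n. continuous_on UNIV (f' n)"
    "\<And>n::nat. \<exists>R. \<forall>s\<ge>R. f n s = 0"
    "\<And>n. (\<integral>\<^sup>+s. ennreal ((norm (f' n s))\<^sup>2 * s\<^sup>2) * indicator {0<..} s \<partial>lborel) \<le> ennreal (4 * K * E)"
    "AE t in lborel. 1 / norm y < t \<longrightarrow> (\<lambda>n. f n t) \<longlonglongrightarrow> U (norm y * t)"
    "AE t in lborel. 1 / norm y < t \<longrightarrow> (\<lambda>n. \<phi> n (t *\<^sub>R y)) \<longlonglongrightarrow> U (norm y * t)"
    "(\<integral>\<^sup>+t. h (t *\<^sub>R y) * ennreal (t\<^sup>2) * indicator {0<..} t \<partial>lborel) \<le> ennreal (K * H)"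
proof -
  have K: "0 < K" by (simp add: K_def ray_constant_pos)
  have gm: "(\<lambda>z. ennreal ((norm (grad (\<phi> n) z))\<^sup>2)) \<in> borel_measurable borel" for n
    using borel_measurable_continuous_onI[OF grad_continuous[OF \<phi>]] by measurable
  have "AE x in lborel. x \<in> exterior \<longrightarrow> u x = U (norm x)"
    using U by (simp add: radial_profile_def AE_lebesgue_on_iff)
  with lim have "AE x in lborel. 1 < norm x \<longrightarrow> (\<lambda>n. \<phi> n x) \<longlonglongrightarrow> U (norm x)"
    by eventually_elim auto
  from exists_good_ray[of "\<lambda>n z. ennreal ((norm (grad (\<phi> n) z))\<^sup>2)", OF gm h(1) E h(2) gE h(3) this]
  obtain y r where y: "1 < norm y" "norm y < 2" and r: "strict_mono r"
    and P: "AE t in lborel. 0 < t \<longrightarrow> 1 < norm (t *\<^sub>R y) \<longrightarrow> (\<lambda>n. \<phi> n (t *\<^sub>R y)) \<longlonglongrightarrow> U (norm (t *\<^sub>R y))"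
    and g: "\<And>n::nat. (\<integral>\<^sup>+t. ennreal ((norm (grad (\<phi> (r n)) (t *\<^sub>R y)))\<^sup>2) * ennreal (t\<^sup>2) * indicator {0<..} t \<partial>lborel) \<le> ennreal (K * E)"
    and hy: "(\<integral>\<^sup>+t. h (t *\<^sub>R y) * ennreal (t\<^sup>2) * indicator {0<..} t \<partial>lborel) \<le> ennreal (K * H)"
    unfolding K_def by auto
  define f where "f n t = \<phi> (r n) (t *\<^sub>R y)" for n t
  define f' where "f' n t = frechet_derivative (\<phi> (r n)) (at (t *\<^sub>R y)) y" for n t
  have "(f n has_vector_derivative f' n s) (at s)" for n s
  proof -
    have "((\<lambda>t. t *\<^sub>R y) has_vector_derivative y) (at s)"
      by (auto intro!: derivative_eq_intros)
    from vector_derivative_diff_chain_within[OF this has_derivative_at_withinI[OF test_functions_has_derivative[OF \<phi>]]]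
    show ?thesis unfolding f_def[abs_def] f'_def by (simp add: o_def)
  qed
  moreover have "continuous_on UNIV (f' n)" for n
    unfolding f'_def[abs_def] frechet_derivative_eq_sum_partial[OF \<phi>]
    by (intro continuous_intros continuous_on_compose2[OF test_functions_continuous[OF partial_test_functions[OF \<phi>]]]) auto
  moreover have "\<exists>R. \<forall>s\<ge>R. f n s = 0" for n
  proof -
    obtain L where L: "compact L" "\<And>x. x \<notin> L \<Longrightarrow> \<phi> (r n) x = 0"
      using test_functions_support[OF \<phi>, of "r n"] by metis
    obtain B where B: "0 < B" "\<And>x. x \<in> L \<Longrightarrow> norm x \<le> B"
      using compact_imp_bounded[OF L(1)] by (metis bounded_pos)
    have "f n s = 0" if "B + 1 \<le> s" for s
    proof -
      have "s * 1 \<le> s * norm y" using that B y by (intro mult_left_mono) auto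
      moreover have "norm (s *\<^sub>R y) = s * norm y" using that B(1) by simp
      ultimately have "B < norm (s *\<^sub>R y)" using that by linarith
      then show ?thesis using L(2) B(2) unfolding f_def by fastforce
    qed
    then show ?thesis by blast
  qed
  moreover have "(\<integral>\<^sup>+s. ennreal ((norm (f' n s))\<^sup>2 * s\<^sup>2) * indicator {0<..} s \<partial>lborel) \<le> ennreal (4 * K * E)" for n
  proof -
    have "(\<integral>\<^sup>+s. ennreal ((norm (f' n s))\<^sup>2 * s\<^sup>2) * indicator {0<..} s \<partial>lborel)
      \<le> (\<integral>\<^sup>+s. 4 * (ennreal ((norm (grad (\<phi> (r n)) (s *\<^sub>R y)))\<^sup>2) * ennreal (s\<^sup>2) * indicator {0<..} s) \<partial>lborel)"
    proof (rule nn_integral_mono)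
      fix s :: real
      let ?g = "norm (grad (\<phi> (r n)) (s *\<^sub>R y))"
      have "norm (f' n s) \<le> norm y * ?g"
        unfolding f'_def by (rule norm_frechet_derivative_le[OF \<phi>])
      also have "\<dots> \<le> 2 * ?g" using y by (intro mult_right_mono) auto
      finally have "(norm (f' n s))\<^sup>2 \<le> (2 * ?g)\<^sup>2" by (intro power_mono) auto
      then have "(norm (f' n s))\<^sup>2 * s\<^sup>2 \<le> 4 * (?g\<^sup>2 * s\<^sup>2)"
        using mult_right_mono[of "(norm (f' n s))\<^sup>2" "(2 * ?g)\<^sup>2" "s\<^sup>2"] by (simp add: power_mult_distrib)
      then have "ennreal ((norm (f' n s))\<^sup>2 * s\<^sup>2) \<le> ennreal (4 * (?g\<^sup>2 * s\<^sup>2))" by (rule ennreal_leI)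
      also have "\<dots> = 4 * (ennreal (?g\<^sup>2) * ennreal (s\<^sup>2))" by (simp add: ennreal_mult)
      finally show "ennreal ((norm (f' n s))\<^sup>2 * s\<^sup>2) * indicator {0<..} s
         \<le> 4 * (ennreal (?g\<^sup>2) * ennreal (s\<^sup>2) * indicator {0<..} s)"
        by (simp add: indicator_def)
    qed
    also have "\<dots> = 4 * (\<integral>\<^sup>+s. ennreal ((norm (grad (\<phi> (r n)) (s *\<^sub>R y)))\<^sup>2) * ennreal (s\<^sup>2) * indicator {0<..} s \<partial>lborel)"
    proof -
      have [measurable]: "grad (\<phi> (r n)) \<in> borel_measurable borel"
        by (rule borel_measurable_continuous_onI[OF grad_continuous[OF \<phi>]])
      show ?thesis by (intro nn_integral_cmult) simp
    qed
    also have "\<dots> \<le> 4 * ennreal (K * E)" by (intro mult_left_mono g) simp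
    also have "\<dots> = ennreal (4 * K * E)" using K E by (simp add: ennreal_mult mult.assoc)
    finally show ?thesis .
  qed
  moreover have conv: "AE t in lborel. 1 / norm y < t \<longrightarrow> (\<lambda>n. \<phi> n (t *\<^sub>R y)) \<longlonglongrightarrow> U (norm y * t)"
    using P
  proof eventually_elim
    case (elim t)
    show ?case
    proof
      assume t: "1 / norm y < t"
      have "0 < 1 / norm y" using y by (intro divide_pos_pos) auto
      then have t0: "0 < t" using t by linarith
      moreover have "norm (t *\<^sub>R y) = norm y * t" using t0 by simp
      moreover have "1 < norm y * t"
        by (rule less_divide_imp_less_mult[OF t y(1)])
      ultimately show "(\<lambda>n. \<phi> n (t *\<^sub>R y)) \<longlonglongrightarrow> U (norm y * t)" using elim by metis
    qed
  qed
  moreover have "AE t in lborel. 1 / norm y < t \<longrightarrow> (\<lambda>n. f n t) \<longlonglongrightarrow> U (norm y * t)"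
    using conv
  proof eventually_elim
    case (elim t)
    then show ?case
      using LIMSEQ_subseq_LIMSEQ[OF _ r] unfolding f_def by (auto simp: o_def)
  qed
  ultimately show thesis
    using y hy by (intro that[of y f f'])
qed

lemma radial_profile_decay:
  fixes \<phi> :: "nat \<Rightarrow> real^3 \<Rightarrow> complex"
  assumes \<phi>: "\<And>n. \<phi> n \<in> test_functions exterior" and E: "0 < E"
    and gE: "\<And>n. (\<integral>\<^sup>+z. ennreal ((norm (grad (\<phi> n) z))\<^sup>2) \<partial>lborel) \<le> ennreal E"
    and lim: "AE x in lborel. x \<in> exterior \<longrightarrow> (\<lambda>n. \<phi> n x) \<longlonglongrightarrow> u x"
    and U: "radial_profile exterior u U"
  defines "K \<equiv> ray_constant TYPE(real^3)"
  shows "AE r in lborel. 1 < r \<longrightarrow> norm (U r) \<le> sqrt (8 * K * E)"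
proof -
  have K: "0 < K" by (simp add: K_def ray_constant_pos)
  \<comment> \<open>The decay rests on the energy alone, so the slot for the p-integrand is filled
    with the zero function.\<close>
  obtain y :: "real^3" and f f'
    where y: "1 < norm y" "norm y < 2"
      and f: "\<And>n s. (f n has_vector_derivative f' n s) (at s)" "\<And>n. continuous_on UNIV (f' n)"
        "\<And>n::nat. \<exists>R. \<forall>s\<ge>R. f n s = 0"
        "\<And>n. (\<integral>\<^sup>+s. ennreal ((norm (f' n s))\<^sup>2 * s\<^sup>2) * indicator {0<..} s \<partial>lborel) \<le> ennreal (4 * K * E)"
        "AE t in lborel. 1 / norm y < t \<longrightarrow> (\<lambda>n. f n t) \<longlonglongrightarrow> U (norm y * t)"
    by (rule good_ray_profile[OF \<phi> E gE lim U, of "\<lambda>_. 0" 1]) (auto simp: K_def)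
  have "AE t in lborel. 1 / norm y < t \<longrightarrow> norm (U (norm y * t)) \<le> sqrt (4 * K * E / t)"
    using y K E by (intro AE_limit_weighted_decay[OF _ f(1-4) _ f(5)]) auto
  from AE_lborel_mult[OF _ this, of "1 / norm y"] y
  have "AE r in lborel. 1 / norm y < 1 / norm y * r \<longrightarrow>
      norm (U (norm y * (1 / norm y * r))) \<le> sqrt (4 * K * E / (1 / norm y * r))" by auto
  then show ?thesis
  proof eventually_elim
    case (elim r)
    show ?case
    proof
      assume r: "1 < r"
      have "1 / norm y < 1 / norm y * r" "norm y * (1 / norm y * r) = r"
        using y r by (auto simp: divide_simps)
      with elim have "norm (U r) \<le> sqrt (4 * K * E / (1 / norm y * r))" by simp
      \<comment> \<open>With t = r / |y| the quotient E / t becomes E |y| / r, and |y| < 2, r > 1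
        turn the factor 4 into 8.\<close>
      also have "4 * K * E / (1 / norm y * r) \<le> 8 * K * E"
      proof -
        have "norm y / r \<le> 2 / 1" using y r by (intro frac_le) auto
        then have "4 * K * E * (norm y / r) \<le> 4 * K * E * 2"
          using K E by (intro mult_left_mono) auto
        then show ?thesis by simp
      qed
      then have "sqrt (4 * K * E / (1 / norm y * r)) \<le> sqrt (8 * K * E)" by simp
      finally show "norm (U r) \<le> sqrt (8 * K * E)" .
    qed
  qed
qed

lemma radial_profile_interpolation:
  fixes \<phi> :: "nat \<Rightarrow> real^3 \<Rightarrow> complex"
  assumes \<phi>: "\<And>n. \<phi> n \<in> test_functions exterior" and E: "0 < E"
    and gE: "\<And>n. (\<integral>\<^sup>+z. ennreal ((norm (grad (\<phi> n) z))\<^sup>2) \<partial>lborel) \<le> ennreal E"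
    and lim: "AE x in lborel. x \<in> exterior \<longrightarrow> (\<lambda>n. \<phi> n x) \<longlonglongrightarrow> u x"
    and U: "radial_profile exterior u U"
    and p: "1 \<le> p"
    and H: "0 < H" "(\<integral>\<^sup>+x. ennreal (norm (u x) powr p) * indicator exterior x \<partial>lborel) \<le> ennreal H"
  defines "K \<equiv> ray_constant TYPE(real^3)"
  shows "AE r in lborel. 1 < r \<longrightarrow> r\<^sup>2 * norm (U r) powr ((p + 2) / 2) \<le> (p + 2) * (4 * K) * sqrt (H * E)"
proof -
  have K: "0 < K" by (simp add: K_def ray_constant_pos)
  \<comment> \<open>Since u need not be Borel measurable, its p-th power is represented by a liminf
    of test functions, which is Borel as the ray formula requires and agrees with |u|^p almost
    everywhere in the domain.\<close>
  define h where "h z = liminf (\<lambda>n. ennreal (norm (\<phi> n z) powr p)) * indicator exterior z" for z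
  have [measurable]: "\<phi> n \<in> borel_measurable borel" for n
    by (rule borel_measurable_continuous_onI[OF test_functions_continuous[OF \<phi>]])
  have hm: "h \<in> borel_measurable borel" unfolding h_def by measurable
  have lp: "liminf (\<lambda>n. ennreal (norm (a n) powr p * c)) = ennreal (norm b powr p * c)"
    if "a \<longlonglongrightarrow> b" for a :: "nat \<Rightarrow> complex" and b c
    using p that by (intro lim_imp_Liminf tendsto_ennrealI tendsto_intros tendsto_powr') auto
  have lp1: "liminf (\<lambda>n. ennreal (norm (a n) powr p)) = ennreal (norm b powr p)"
    if "a \<longlonglongrightarrow> b" for a :: "nat \<Rightarrow> complex" and b
    using lp[OF that, of 1] by simp
  have "(\<integral>\<^sup>+z. h z \<partial>lborel) = (\<integral>\<^sup>+x. ennreal (norm (u x) powr p) * indicator exterior x \<partial>lborel)"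
  proof (rule nn_integral_cong_AE)
    show "AE z in lborel. h z = ennreal (norm (u z) powr p) * indicator exterior z"
      using lim
    proof eventually_elim
      case (elim z)
      then show ?case by (cases "z \<in> exterior") (auto simp: h_def lp1 simp del: mem_exterior)
    qed
  qed
  with H have hH: "(\<integral>\<^sup>+z. h z \<partial>lborel) \<le> ennreal H" by simp
  obtain y :: "real^3" and f f'
    where y: "1 < norm y" "norm y < 2"
      and f: "\<And>n s. (f n has_vector_derivative f' n s) (at s)" "\<And>n. continuous_on UNIV (f' n)"
        "\<And>n::nat. \<exists>R. \<forall>s\<ge>R. f n s = 0"
        "\<And>n. (\<integral>\<^sup>+s. ennreal ((norm (f' n s))\<^sup>2 * s\<^sup>2) * indicator {0<..} s \<partial>lborel) \<le> ennreal (4 * K * E)"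
        "AE t in lborel. 1 / norm y < t \<longrightarrow> (\<lambda>n. f n t) \<longlonglongrightarrow> U (norm y * t)"
      and \<phi>y: "AE t in lborel. 1 / norm y < t \<longrightarrow> (\<lambda>n. \<phi> n (t *\<^sub>R y)) \<longlonglongrightarrow> U (norm y * t)"
      and hy: "(\<integral>\<^sup>+t. h (t *\<^sub>R y) * ennreal (t\<^sup>2) * indicator {0<..} t \<partial>lborel) \<le> ennreal (K * H)"
    by (rule good_ray_profile[OF \<phi> E gE lim U hm H(1) hH]) (auto simp: K_def)
  have y0: "0 < 1 / norm y" using y by (intro divide_pos_pos) auto
  have "(\<integral>\<^sup>+s. liminf (\<lambda>n. ennreal (norm (f n s) powr p * s\<^sup>2)) * indicator {1 / norm y<..} s \<partial>lborel)
     \<le> (\<integral>\<^sup>+t. h (t *\<^sub>R y) * ennreal (t\<^sup>2) * indicator {0<..} t \<partial>lborel)"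
  proof (rule nn_integral_mono_AE)
    show "AE s in lborel. liminf (\<lambda>n. ennreal (norm (f n s) powr p * s\<^sup>2)) * indicator {1 / norm y<..} s
       \<le> h (s *\<^sub>R y) * ennreal (s\<^sup>2) * indicator {0<..} s"
      using f(5) \<phi>y
    proof eventually_elim
      case (elim s)
      show ?case
      proof (cases "1 / norm y < s")
        case True
        have "0 < s" using y0 True by linarith
        moreover have "1 < s * norm y" using less_divide_imp_less_mult[OF True y(1)] by (simp add: mult.commute)
        ultimately have s: "0 < s" "s *\<^sub>R y \<in> exterior" by auto
        have "liminf (\<lambda>n. ennreal (norm (f n s) powr p * s\<^sup>2)) = ennreal (norm (U (norm y * s)) powr p * s\<^sup>2)"
          using elim True by (intro lp) auto
        also have "\<dots> = h (s *\<^sub>R y) * ennreal (s\<^sup>2)"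
          using elim True s by (simp add: h_def lp1 ennreal_mult)
        finally show ?thesis using s by (simp add: indicator_def)
      qed simp
    qed
  qed
  also note hy
  finally have "AE t in lborel. 1 / norm y < t \<longrightarrow>
      t\<^sup>2 * norm (U (norm y * t)) powr ((p + 2) / 2) \<le> (p + 2) / 2 * sqrt (K * H * (4 * K * E))"
    using y0 K E p H
    by (intro AE_limit_weighted_interpolation[OF _ f(1-4) _ f(5)]) auto
  from AE_lborel_mult[OF _ this, of "1 / norm y"] y
  have "AE r in lborel. 1 / norm y < 1 / norm y * r \<longrightarrow> (1 / norm y * r)\<^sup>2 *
      norm (U (norm y * (1 / norm y * r))) powr ((p + 2) / 2) \<le> (p + 2) / 2 * sqrt (K * H * (4 * K * E))" by auto
  then show ?thesis
  proof eventually_elim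
    case (elim r)
    show ?case
    proof
      assume r: "1 < r"
      let ?X = "norm (U r) powr ((p + 2) / 2)"
      have "1 / norm y < 1 / norm y * r" "norm y * (1 / norm y * r) = r"
        using y r by (auto simp: divide_simps)
      with elim have 1: "(1 / norm y * r)\<^sup>2 * ?X \<le> (p + 2) / 2 * sqrt (K * H * (4 * K * E))" by simp
      \<comment> \<open>Origin of the constant: the root contributes 2 K, which the prefactor (p +
        2) / 2 turns into (p + 2) K; squaring r \<le> 2 r / |y| below contributes the remaining
        4.\<close>
      have "sqrt (K * H * (4 * K * E)) = sqrt ((2 * K)\<^sup>2 * (H * E))"
        by (simp add: power2_eq_square mult_ac)
      also have "\<dots> = 2 * K * sqrt (H * E)"
        using K by (simp add: real_sqrt_mult)
      finally have 2: "(1 / norm y * r)\<^sup>2 * ?X \<le> (p + 2) * K * sqrt (H * E)" using 1 by simp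
      have "r \<le> 2 * (1 / norm y * r)" using mult_left_mono[of "norm y" 2 r] y r by (simp add: pos_le_divide_eq[OF less_trans[OF zero_less_one y(1)]])
      then have "r\<^sup>2 \<le> (2 * (1 / norm y * r))\<^sup>2" using r by (intro power_mono) auto
      then have "r\<^sup>2 * ?X \<le> (2 * (1 / norm y * r))\<^sup>2 * ?X" by (intro mult_right_mono) auto
      also have "\<dots> = 4 * ((1 / norm y * r)\<^sup>2 * ?X)" unfolding power_mult_distrib[of 2] by simp
      also have "\<dots> \<le> 4 * ((p + 2) * K * sqrt (H * E))" using 2 by simp
      also have "\<dots> = (p + 2) * (4 * K) * sqrt (H * E)" by simp
      finally show "r\<^sup>2 * ?X \<le> (p + 2) * (4 * K) * sqrt (H * E)" .
    qed
  qed
qed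

section \<open>The homogeneous Sobolev space\<close>

lemma nn_integral_grad:
  assumes "S \<in> sets lebesgue" "f \<in> test_functions S"
  shows "(\<integral>\<^sup>+z. ennreal ((norm (grad f z))\<^sup>2) \<partial>lborel) = ennreal ((Lp_norm 2 S (grad f))\<^sup>2)"
proof -
  have "integrable (lebesgue_on S) (\<lambda>x. (norm (grad f x))\<^sup>2)"
    using grad_Lp_2[OF assms] by (simp add: Lp_def)
  then have "ennreal ((Lp_norm 2 S (grad f))\<^sup>2) = (\<integral>\<^sup>+z. ennreal ((norm (grad f z))\<^sup>2) \<partial>lebesgue_on S)"
    by (simp add: nn_integral_eq_integral power2_Lp_norm_2)
  also have "\<dots> = (\<integral>\<^sup>+z. ennreal ((norm (grad f z))\<^sup>2) \<partial>lborel)"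
    unfolding nn_integral_lebesgue_on[OF assms(1)]
    by (intro nn_integral_cong) (auto simp: indicator_def grad_eq_0[OF assms(2)])
  finally show ?thesis ..
qed

text \<open>The squared triangle inequality with a factor 2; it serves to bound the norms along a
  Cauchy sequence.\<close>

lemma Lp_norm_grad_le:
  assumes "S \<in> sets lebesgue" "f \<in> test_functions S" "g \<in> test_functions S"
  shows "(Lp_norm 2 S (grad f))\<^sup>2 \<le> 2 * (Lp_norm 2 S (grad (\<lambda>x. f x - g x)))\<^sup>2 + 2 * (Lp_norm 2 S (grad g))\<^sup>2"
proof -
  have i: "integrable (lebesgue_on S) (\<lambda>x. (norm (grad h x))\<^sup>2)" if "h \<in> test_functions S" for h
    using grad_Lp_2[OF assms(1) that] by (simp add: Lp_def)
  note i' = i[OF assms(2)] i[OF assms(3)] i[OF test_functions_diff[OF assms(2,3)]]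
  have "(LINT x|lebesgue_on S. (norm (grad f x))\<^sup>2)
    \<le> (LINT x|lebesgue_on S. 2 * (norm (grad (\<lambda>x. f x - g x) x))\<^sup>2 + 2 * (norm (grad g x))\<^sup>2)"
  proof (rule integral_mono)
    fix x
    have "norm (grad f x) \<le> norm (grad f x - grad g x) + norm (grad g x)"
      using norm_triangle_ineq[of "grad f x - grad g x" "grad g x"] by simp
    then have "(norm (grad f x))\<^sup>2 \<le> (norm (grad f x - grad g x) + norm (grad g x))\<^sup>2"
      by (intro power_mono) auto
    also have "\<dots> \<le> 2 * (norm (grad f x - grad g x))\<^sup>2 + 2 * (norm (grad g x))\<^sup>2"
      using sum_squares_bound[of "norm (grad f x - grad g x)" "norm (grad g x)"] by (simp add: power2_sum)
    finally show "(norm (grad f x))\<^sup>2 \<le> 2 * (norm (grad (\<lambda>x. f x - g x) x))\<^sup>2 + 2 * (norm (grad g x))\<^sup>2"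
      by (simp add: grad_diff[OF assms(2,3)])
  qed (use i' in auto)
  then show ?thesis using i' by (simp add: power2_Lp_norm_2)
qed

text \<open>
  The infimum over no square root is \<open>\<infinity>\<close>, which is incompatible with the Cauchy condition; hence the
  existence of a square root need not be proved.
\<close>

lemma Hdot1_approx_op_sqrt_nonempty:
  assumes "Hdot1_approx S \<phi> u"
  shows "op_sqrt S (neg_Dirichlet_Laplacian S) \<noteq> {}"
proof
  assume "op_sqrt S (neg_Dirichlet_Laplacian S) = {}"
  then have "sqrt_Laplacian_norm S f = top" for f by (simp add: sqrt_Laplacian_norm_def)
  moreover obtain N where "\<forall>m\<ge>N. \<forall>n\<ge>N. sqrt_Laplacian_norm S (\<lambda>x. \<phi> m x - \<phi> n x) < ennreal 1"
    using assms unfolding Hdot1_approx_def by (metis zero_less_one)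
  ultimately show False by auto
qed

lemma Hdot1_approx_test_functions: "Hdot1_approx S \<phi> u \<Longrightarrow> \<phi> n \<in> test_functions S"
  by (simp add: Hdot1_approx_def)

lemma Hdot1_approx_norm:
  assumes "S \<in> sets lebesgue" "Hdot1_approx S \<phi> u" "f \<in> test_functions S"
  shows "sqrt_Laplacian_norm S f = ennreal (Lp_norm 2 S (grad f))"
  using assms by (intro sqrt_Laplacian_norm_test_functions Hdot1_approx_op_sqrt_nonempty)

lemma Hdot1_approx_subseq:
  assumes a: "Hdot1_approx S \<phi> u" and r: "strict_mono r"
  shows "Hdot1_approx S (\<lambda>n. \<phi> (r n)) u"
  unfolding Hdot1_approx_def
proof (intro conjI allI impI)
  show "\<phi> (r n) \<in> test_functions S" for n using a by (simp add: Hdot1_approx_def)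
  fix e :: real assume "0 < e"
  then obtain N where N: "\<forall>m\<ge>N. \<forall>n\<ge>N. sqrt_Laplacian_norm S (\<lambda>x. \<phi> m x - \<phi> n x) < ennreal e"
    using a unfolding Hdot1_approx_def by blast
  then show "\<exists>N. \<forall>m\<ge>N. \<forall>n\<ge>N. sqrt_Laplacian_norm S (\<lambda>x. \<phi> (r m) x - \<phi> (r n) x) < ennreal e"
    using order_trans[OF _ seq_suble[OF r]] by blast
next
  fix K assume "compact K \<and> K \<subseteq> S"
  then show "u \<in> Lp 1 K" "(\<lambda>n. Lp_norm 1 K (\<lambda>x. \<phi> (r n) x - u x)) \<longlonglongrightarrow> 0"
    using a LIMSEQ_subseq_LIMSEQ[OF _ r, of "\<lambda>n. Lp_norm 1 K (\<lambda>x. \<phi> n x - u x)" 0]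
    unfolding Hdot1_approx_def by (auto simp: o_def)
qed

lemma Hdot1_approx_bounded:
  assumes S: "S \<in> sets lebesgue" and a: "Hdot1_approx S \<phi> u"
  shows "\<exists>N B. \<forall>n\<ge>N. Lp_norm 2 S (grad (\<phi> n)) \<le> B"
proof -
  note t = Hdot1_approx_test_functions[OF a]
  obtain N where N: "\<forall>m\<ge>N. \<forall>n\<ge>N. sqrt_Laplacian_norm S (\<lambda>x. \<phi> m x - \<phi> n x) < ennreal 1"
    using a unfolding Hdot1_approx_def by (metis zero_less_one)
  have "Lp_norm 2 S (grad (\<phi> n)) \<le> sqrt (2 * 1\<^sup>2 + 2 * (Lp_norm 2 S (grad (\<phi> N)))\<^sup>2)" if "N \<le> n" for n
  proof -
    have "Lp_norm 2 S (grad (\<lambda>x. \<phi> n x - \<phi> N x)) < 1"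
      using N that Hdot1_approx_norm[OF S a test_functions_diff[OF t t]] by (auto simp: ennreal_less_iff Lp_norm_2_nonneg simp flip: ennreal_1)
    then have "(Lp_norm 2 S (grad (\<lambda>x. \<phi> n x - \<phi> N x)))\<^sup>2 \<le> 1\<^sup>2"
      using Lp_norm_2_nonneg by (intro power_mono) auto
    then have "(Lp_norm 2 S (grad (\<phi> n)))\<^sup>2 \<le> 2 * 1\<^sup>2 + 2 * (Lp_norm 2 S (grad (\<phi> N)))\<^sup>2"
      using Lp_norm_grad_le[OF S t[of n] t[of N]] by linarith
    then show ?thesis by (rule real_le_rsqrt)
  qed
  then show ?thesis by blast
qed

text \<open>This provides a finite member of the set whose infimum defines
  \<open>Hdot1_norm\<close>. Norms are bounded along a tail of a Cauchy sequence, and a subsequence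
  with convergent norms still approximates u.\<close>

lemma Hdot1_approx_convergent:
  assumes S: "S \<in> sets lebesgue" and a: "Hdot1_approx S \<phi> u"
  shows "\<exists>\<psi> c. Hdot1_approx S \<psi> u \<and> 0 \<le> c \<and> (\<lambda>n. sqrt_Laplacian_norm S (\<psi> n)) \<longlonglongrightarrow> ennreal c"
proof -
  obtain N B where NB: "\<And>n. n \<ge> N \<Longrightarrow> Lp_norm 2 S (grad (\<phi> n)) \<le> B"
    using Hdot1_approx_bounded[OF S a] by blast
  define \<eta> where "\<eta> n = \<phi> (n + N)" for n
  have \<eta>: "Hdot1_approx S \<eta> u"
    unfolding \<eta>_def by (rule Hdot1_approx_subseq[OF a]) (simp add: strict_mono_def)
  define b where "b n = Lp_norm 2 S (grad (\<eta> n))" for n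
  have "\<forall>n. b n \<in> {0..B}"
    using NB Lp_norm_2_nonneg by (auto simp: b_def \<eta>_def)
  then obtain c r where r: "c \<in> {0..B}" "strict_mono (r :: nat \<Rightarrow> nat)" "(b \<circ> r) \<longlonglongrightarrow> c"
    using compact_def[THEN iffD1, OF compact_Icc[of 0 B], rule_format, of b] by auto
  then have "(\<lambda>n. ennreal (Lp_norm 2 S (grad (\<eta> (r n))))) \<longlonglongrightarrow> ennreal c"
    by (intro tendsto_ennrealI) (simp add: o_def b_def)
  then have "(\<lambda>n. sqrt_Laplacian_norm S (\<eta> (r n))) \<longlonglongrightarrow> ennreal c"
    by (simp add: Hdot1_approx_norm[OF S \<eta> Hdot1_approx_test_functions[OF \<eta>]])
  then show ?thesis using Hdot1_approx_subseq[OF \<eta> r(2)] r(1) by auto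
qed

lemma Hdot1_norm_less:
  assumes S: "S \<in> sets lebesgue" and u: "u \<in> Hdot1 S" and d: "Hdot1_norm S u < d"
  shows "\<exists>\<phi> c. Hdot1_approx S \<phi> u \<and> 0 \<le> c \<and> c < d \<and> (\<lambda>n. sqrt_Laplacian_norm S (\<phi> n)) \<longlonglongrightarrow> ennreal c"
proof -
  let ?I = "{c. \<exists>\<phi>. Hdot1_approx S \<phi> u \<and> (\<lambda>n. sqrt_Laplacian_norm S (\<phi> n)) \<longlonglongrightarrow> c}"
  obtain \<psi> c0 where "Hdot1_approx S \<psi> u" "(\<lambda>n. sqrt_Laplacian_norm S (\<psi> n)) \<longlonglongrightarrow> ennreal c0"
    using u Hdot1_approx_convergent[OF S, of _ u] unfolding Hdot1_def mem_Collect_eq by metis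
  then have "ennreal c0 \<in> ?I" by (intro CollectI exI[of _ \<psi>] conjI)
  then have "Inf ?I \<le> ennreal c0" by (rule Inf_lower)
  \<comment> \<open>Finiteness matters because \<open>enn2real\<close> sends infinity to 0; an
    infinite infimum would pass for norm zero.\<close>
  then have fin: "Inf ?I < top" using ennreal_less_top le_less_trans by blast
  have "0 \<le> Hdot1_norm S u" by (simp add: Hdot1_norm_def)
  moreover have "Inf ?I = ennreal (Hdot1_norm S u)"
    using fin by (simp add: Hdot1_norm_def)
  ultimately have "Inf ?I < ennreal d" using d by (simp add: ennreal_lessI)
  then obtain c where "c \<in> ?I" "c < ennreal d" by (auto simp: Inf_less_iff)
  moreover from this(2) obtain c' where "c = ennreal c'" "0 \<le> c'" by (cases c) auto
  ultimately show ?thesis by (auto simp: ennreal_less_iff)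
qed

lemma Hdot1_AE_test_sequence:
  assumes u: "u \<in> Hdot1 exterior" and E: "(Hdot1_norm exterior u)\<^sup>2 < E"
  obtains \<phi> where "\<And>n. \<phi> n \<in> test_functions exterior"
     "\<And>n. (\<integral>\<^sup>+z. ennreal ((norm (grad (\<phi> n) z))\<^sup>2) \<partial>lborel) \<le> ennreal E"
     "AE x in lborel. x \<in> exterior \<longrightarrow> (\<lambda>n::nat. \<phi> n x) \<longlonglongrightarrow> u x"
proof -
  have "Hdot1_norm exterior u < sqrt E" using E by (rule real_less_rsqrt)
  from Hdot1_norm_less[OF _ u this] obtain \<phi> c where a: "Hdot1_approx exterior \<phi> u" and c: "0 \<le> c" "c < sqrt E"
    and lim: "(\<lambda>n. sqrt_Laplacian_norm exterior (\<phi> n)) \<longlonglongrightarrow> ennreal c" by auto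
  note t = Hdot1_approx_test_functions[OF a]
  have "\<forall>\<^sub>F n in sequentially. sqrt_Laplacian_norm exterior (\<phi> n) < ennreal (sqrt E)"
    using lim c by (intro order_tendstoD) (auto simp: ennreal_less_iff)
  then obtain N where N: "\<And>n. n \<ge> N \<Longrightarrow> sqrt_Laplacian_norm exterior (\<phi> n) < ennreal (sqrt E)"
    by (auto simp: eventually_sequentially)
  obtain r where r: "strict_mono r" "AE x in lborel. x \<in> exterior \<longrightarrow> (\<lambda>n. \<phi> (r n) x) \<longlonglongrightarrow> u x"
  proof -
    have "u \<in> Lp 1 L \<and> (\<lambda>n. Lp_norm 1 L (\<lambda>x. \<phi> n x - u x)) \<longlonglongrightarrow> 0"
      if "compact L" "L \<subseteq> exterior" for L
      using a that by (simp add: Hdot1_approx_def)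
    then show thesis
      using L1loc_AE_convergent_subsequence[of exterior \<phi> u, OF open_exterior test_functions_continuous[OF t]] that
      by auto
  qed
  \<comment> \<open>The shift by N puts every term, and not only almost every one, below the energy
    bound, since \<open>r (n + N)\<close> is at least N.\<close>
  define \<psi> where "\<psi> n = \<phi> (r (n + N))" for n
  have "(\<integral>\<^sup>+z. ennreal ((norm (grad (\<psi> n) z))\<^sup>2) \<partial>lborel) \<le> ennreal E" for n
  proof -
    have "N \<le> r (n + N)" using seq_suble[OF r(1), of "n + N"] by simp
    from N[OF this] have "Lp_norm 2 exterior (grad (\<psi> n)) < sqrt E"
      unfolding \<psi>_def by (simp add: Hdot1_approx_norm[OF _ a t] ennreal_less_iff Lp_norm_2_nonneg)
    then have "(Lp_norm 2 exterior (grad (\<psi> n)))\<^sup>2 \<le> (sqrt E)\<^sup>2"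
      using Lp_norm_2_nonneg by (intro power_mono) auto
    moreover have "0 \<le> E" using E by (meson less_imp_le order_trans zero_le_power2)
    ultimately show ?thesis
      using nn_integral_grad[OF _ t, of "r (n + N)"] by (simp add: \<psi>_def ennreal_leI)
  qed
  moreover have "AE x in lborel. x \<in> exterior \<longrightarrow> (\<lambda>n. \<psi> n x) \<longlonglongrightarrow> u x"
    using r(2)
  proof eventually_elim
    case (elim x)
    then show ?case unfolding \<psi>_def by (auto intro: LIMSEQ_ignore_initial_segment)
  qed
  ultimately show thesis using t by (intro that[of \<psi>]) (auto simp: \<psi>_def)
qed

section \<open>Pointwise bounds for radial elements of the completion\<close>

lemma Hdot1_radial_bounded:
  assumes u: "u \<in> Hdot1 exterior" and U: "radial_profile exterior u U"
  shows "\<exists>M. AE r in lborel. 1 < r \<longrightarrow> norm (U r) \<le> M"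
proof -
  define E where "E = (Hdot1_norm exterior u)\<^sup>2 + 1"
  have E: "(Hdot1_norm exterior u)\<^sup>2 < E" "0 < E" by (auto simp: E_def intro: add_nonneg_pos)
  obtain \<phi> where \<phi>: "\<And>n. \<phi> n \<in> test_functions exterior"
     "\<And>n. (\<integral>\<^sup>+z. ennreal ((norm (grad (\<phi> n) z))\<^sup>2) \<partial>lborel) \<le> ennreal E"
     "AE x in lborel. x \<in> exterior \<longrightarrow> (\<lambda>n::nat. \<phi> n x) \<longlonglongrightarrow> u x"
    using Hdot1_AE_test_sequence[OF u E(1)] by blast
  show ?thesis using radial_profile_decay[OF \<phi>(1) E(2) \<phi>(2,3) U] by blast
qed

lemma Hdot1_radial_interpolation:
  assumes u: "u \<in> Hdot1 exterior" "u \<in> Lp p exterior" and U: "radial_profile exterior u U" and p: "1 \<le> p"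
  defines "K \<equiv> 4 * ray_constant TYPE(real^3)"
  shows "AE r in lborel. 1 < r \<longrightarrow> r\<^sup>2 * norm (U r) powr ((p + 2) / 2)
      \<le> (p + 2) * K * (sqrt (LINT x|lebesgue_on exterior. norm (u x) powr p) * Hdot1_norm exterior u)"
proof -
  define D where "D = Hdot1_norm exterior u"
  have D: "0 \<le> D" by (simp add: D_def Hdot1_norm_def)
  \<comment> \<open>Approximating sequences are available for energies strictly above the squared
    norm, and the estimates ask for positive bounds; \<open>E n\<close>, and \<open>H n\<close>
    below, meet both demands even when a norm vanishes. A countable family keeps the union of the
    exceptional sets null.\<close>
  define E where "E n = D\<^sup>2 + inverse (real (Suc n))" for n
  have E: "(Hdot1_norm exterior u)\<^sup>2 < E n" "0 < E n" for n
    by (auto simp: E_def D_def intro: add_nonneg_pos)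
  define a where "a = (LINT x|lebesgue_on exterior. norm (u x) powr p)"
  have a0: "0 \<le> a" by (simp add: a_def integral_nonneg)
  have ua: "(\<integral>\<^sup>+x. ennreal (norm (u x) powr p) * indicator exterior x \<partial>lborel) = ennreal a"
    using u(2) by (simp add: nn_integral_lebesgue_on[symmetric] a_def Lp_def nn_integral_eq_integral)
  define H where "H n = a + inverse (real (Suc n))" for n
  have H: "a \<le> H n" "0 < H n" for n
    using a0 by (auto simp: H_def intro: add_nonneg_pos simp del: of_nat_Suc)
  have "AE r in lborel. 1 < r \<longrightarrow> r\<^sup>2 * norm (U r) powr ((p + 2) / 2) \<le> (p + 2) * K * sqrt (H n * E n)" for n
  proof -
    obtain \<phi> where \<phi>: "\<And>m. \<phi> m \<in> test_functions exterior"
       "\<And>m. (\<integral>\<^sup>+z. ennreal ((norm (grad (\<phi> m) z))\<^sup>2) \<partial>lborel) \<le> ennreal (E n)"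
       "AE x in lborel. x \<in> exterior \<longrightarrow> (\<lambda>m::nat. \<phi> m x) \<longlonglongrightarrow> u x"
      using Hdot1_AE_test_sequence[OF u(1) E(1)[of n]] by blast
    have "(\<integral>\<^sup>+x. ennreal (norm (u x) powr p) * indicator exterior x \<partial>lborel) \<le> ennreal (H n)"
      unfolding ua using H(1) by (rule ennreal_leI)
    from radial_profile_interpolation[OF \<phi>(1) E(2) \<phi>(2,3) U p H(2) this] show ?thesis
      unfolding K_def .
  qed
  then have "AE r in lborel. \<forall>n. 1 < r \<longrightarrow> r\<^sup>2 * norm (U r) powr ((p + 2) / 2) \<le> (p + 2) * K * sqrt (H n * E n)"
    by (intro AE_all_countable[THEN iffD2] allI)
  then show ?thesis
  proof eventually_elim
    case (elim r)
    show ?case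
    proof
      assume "1 < r"
      have "(\<lambda>n. (p + 2) * K * sqrt (H n * E n)) \<longlonglongrightarrow> (p + 2) * K * sqrt ((a + 0) * (D\<^sup>2 + 0))"
        unfolding H_def E_def by (intro tendsto_intros LIMSEQ_inverse_real_of_nat)
      then have "r\<^sup>2 * norm (U r) powr ((p + 2) / 2) \<le> (p + 2) * K * sqrt ((a + 0) * (D\<^sup>2 + 0))"
        using elim \<open>1 < r\<close> by (intro LIMSEQ_le_const) auto
      also have "sqrt ((a + 0) * (D\<^sup>2 + 0)) = sqrt a * D" using D by (simp add: real_sqrt_mult)
      finally show "r\<^sup>2 * norm (U r) powr ((p + 2) / 2)
        \<le> (p + 2) * K * (sqrt (LINT x|lebesgue_on exterior. norm (u x) powr p) * Hdot1_norm exterior u)"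
        by (simp add: a_def D_def)
    qed
  qed
qed

theorem proposition2p7:
  fixes p :: real
  assumes "1 \<le> p"
  shows "(\<exists>C::real. \<forall>u U. u \<in> Hdot1 exterior \<inter> Lp p exterior \<and> radial_profile exterior u U \<longrightarrow>
            (AE r in lebesgue_on {1..}.
               r powr (4 / (p + 2)) * norm (U r)
                 \<le> C * Lp_norm p exterior u powr (p / (p + 2))
                     * Hdot1_norm exterior u powr (2 / (p + 2))))
         \<and> {u \<in> Hdot1 exterior. radial exterior u} \<subseteq> Linfty exterior"
proof
  define K where "K = 4 * ray_constant TYPE(real^3)"
  have K: "0 < K" by (simp add: K_def ray_constant_pos)
  \<comment> \<open>The estimate bounds r^2 |U(r)|^((p+2)/2). Raising it to the power 2 / (p + 2)
    isolates |U(r)|, and C is what becomes of the factor (p + 2) K.\<close>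
  define C where "C = ((p + 2) * K) powr (2 / (p + 2))"
  show "\<exists>C::real. \<forall>u U. u \<in> Hdot1 exterior \<inter> Lp p exterior \<and> radial_profile exterior u U \<longrightarrow>
            (AE r in lebesgue_on {1..}.
               r powr (4 / (p + 2)) * norm (U r)
                 \<le> C * Lp_norm p exterior u powr (p / (p + 2))
                     * Hdot1_norm exterior u powr (2 / (p + 2)))"
  proof (intro exI[of _ C] allI impI)
    fix u U assume "u \<in> Hdot1 exterior \<inter> Lp p exterior \<and> radial_profile exterior u U"
    then have u: "u \<in> Hdot1 exterior" "u \<in> Lp p exterior" "radial_profile exterior u U" by auto
    define a where "a = (LINT x|lebesgue_on exterior. norm (u x) powr p)"
    define D where "D = Hdot1_norm exterior u"
    have a0: "0 \<le> a" and D0: "0 \<le> D" by (simp_all add: a_def integral_nonneg D_def Hdot1_norm_def)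
    have "AE r in lborel. 1 < r \<longrightarrow> r\<^sup>2 * norm (U r) powr ((p + 2) / 2) \<le> (p + 2) * K * (sqrt a * D)"
      using Hdot1_radial_interpolation[OF u assms] by (simp add: a_def D_def K_def)
    then have "AE r in lborel. r \<in> {1..} \<longrightarrow> r powr (4 / (p + 2)) * norm (U r)
       \<le> C * Lp_norm p exterior u powr (p / (p + 2)) * Hdot1_norm exterior u powr (2 / (p + 2))"
      \<comment> \<open>The estimate concerns r > 1; the endpoint r = 1 is discarded as a null
        set.\<close>
      using AE_lborel_singleton[of 1]
    proof eventually_elim
      case (elim r)
      show ?case
      proof
        assume "r \<in> {1..}"
        with elim have r: "1 < r" by auto
        let ?q = "2 / (p + 2)"
        have "(r\<^sup>2 * norm (U r) powr ((p + 2) / 2)) powr ?q \<le> ((p + 2) * K * (sqrt a * D)) powr ?q"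
          using elim r assms by (intro powr_mono2) auto
        also have "(r\<^sup>2 * norm (U r) powr ((p + 2) / 2)) powr ?q = r powr (4 / (p + 2)) * norm (U r)"
        proof -
          have "(p + 2) / 2 * ?q = 1" "2 * ?q = 4 / (p + 2)" using assms by auto
          moreover have "(r\<^sup>2 * norm (U r) powr ((p + 2) / 2)) powr ?q
              = (r powr 2) powr ?q * (norm (U r) powr ((p + 2) / 2)) powr ?q"
            using r by (simp add: powr_mult)
          ultimately show ?thesis by (simp only: powr_powr) simp
        qed
        also have "((p + 2) * K * (sqrt a * D)) powr ?q = C * (sqrt a powr ?q * D powr ?q)"
          using K assms a0 D0 by (simp add: powr_mult C_def)
        \<comment> \<open>Here a is the p-th power of the norm of u, so its power 1 / (p + 2) is the
          norm to the power p / (p + 2).\<close>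
        also have "sqrt a powr ?q = Lp_norm p exterior u powr (p / (p + 2))"
          using assms a0 by (simp add: Lp_norm_def a_def[symmetric] powr_half_sqrt[symmetric] powr_powr)
        finally show "r powr (4 / (p + 2)) * norm (U r)
          \<le> C * Lp_norm p exterior u powr (p / (p + 2)) * Hdot1_norm exterior u powr (2 / (p + 2))"
          by (simp add: D_def mult.assoc)
      qed
    qed
    then show "AE r in lebesgue_on {1..}. r powr (4 / (p + 2)) * norm (U r)
       \<le> C * Lp_norm p exterior u powr (p / (p + 2)) * Hdot1_norm exterior u powr (2 / (p + 2))"
      by (simp add: AE_lebesgue_on_iff)
  qed
  show "{u \<in> Hdot1 exterior. radial exterior u} \<subseteq> Linfty exterior"
  proof
    fix u assume "u \<in> {u \<in> Hdot1 exterior. radial exterior u}"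
    then obtain U where u: "u \<in> Hdot1 exterior" and U: "radial_profile exterior u U"
      by (auto simp: radial_def)
    obtain M where "AE r in lborel. 1 < r \<longrightarrow> norm (U r) \<le> M" using Hdot1_radial_bounded[OF u U] by blast
    then have "AE x::real^3 in lborel. 1 < norm x \<longrightarrow> norm (U (norm x)) \<le> M"
      by (rule AE_lborel_norm)
    moreover have "AE x in lborel. x \<in> exterior \<longrightarrow> u x = U (norm x)"
      using U by (simp add: radial_profile_def AE_lebesgue_on_iff)
    ultimately have "AE x in lborel. x \<in> exterior \<longrightarrow> norm (u x) \<le> M"
      by eventually_elim auto
    then have "AE x in lebesgue_on exterior. norm (u x) \<le> M"
      by (simp add: AE_lebesgue_on_iff)
    moreover have "u \<in> borel_measurable (lebesgue_on exterior)"
    proof (rule open_compact_exhaustion_measurable[OF open_exterior])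
      fix L :: "(real^3) set" assume "compact L" "L \<subseteq> exterior"
      then show "u \<in> borel_measurable (lebesgue_on L)"
        using u unfolding Hdot1_def Hdot1_approx_def Lp_def by blast
    qed
    ultimately show "u \<in> Linfty exterior" by (auto simp: Linfty_def)
  qed
qed

end
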